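(* Let $d>2$ be an integer, let $\mathcal{A}\subset\mathbb{R}^d$ be compact, and let $\mathcal{S}$ be a Steiner tree for $\mathcal{A}$ with $\mathcal{H}^1(\mathcal{S})<\infty$. Assume that for some $s>0$ and some $x\in\mathbb{R}^d$ the open ball $B_s(x)$ has empty intersection with $\mathcal{A}$, and let $\rho\in(0,1)$. Then the set $\mathcal{S}\cap B_{\rho s}(x)$ consists of at most \[ \left(\frac{144d}{1-\rho}\right)^{d-1} \] line segments (i.e. it is a union of at most that many line segments). In particular, the number of branching points of $\mathcal{S}$ inside the ball $B_{\rho s}(x)$ is bounded by the same quantity.
   Context: $\mathcal{H}^1$ is the one-dimensional Hausdorff measure on $\mathbb{R}^d$ and $B_r(x)$ is the open Euclidean ball of radius $r$ centered at $x$. For $\mathcal{A}\subset\mathbb{R}^d$ compact, a closed set $\mathcal{S}\subset\mathbb{R}^d$ is a Steiner set for $\mathcal{A}$ if $\mathcal{S}\cup\mathcal{A}$ is connected and $\mathcal{H}^1(\mathcal{S})\le\mathcal{H}^1(S)$ for every $S\subset\mathbb{R}^d$ such that $S\cup\mathcal{A}$ is connected. A Steiner tree for $\mathcal{A}$ is a Steiner set for $\mathcal{A}$ that is itself connected. Line segments here are not required to contain their endpoints (they may be cut by the open ball). A branching point of $\mathcal{S}$ is a point at which three edges (segments) of $\mathcal{S}$ meet; for a point $y\in\mathcal{S}\setminus\mathcal{A}$ this means that for all sufficiently small $\varepsilon>0$ the set $\mathcal{S}\cap B_\varepsilon(y)$ is a regular tripod, i.e. the union of three coplanar segments emanating from $y$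 with pairwise angles $2\pi/3$. *)

theory Defs
  imports "HOL-Analysis.Analysis"
begin

(* One-dimensional Hausdorff (outer) measure, with coefficient 1, so that the measure of a
   segment is its length.  Covering sets must be bounded because the library's diameter is
   an unspecified real number on unbounded sets. *)
definition hausdorff1_pre :: "real \<Rightarrow> 'a::metric_space set \<Rightarrow> ennreal" where
  "hausdorff1_pre \<delta> S =
     (INF U \<in> {U :: nat \<Rightarrow> 'a set. S \<subseteq> (\<Union>i. U i) \<and> (\<forall>i. bounded (U i) \<and> diameter (U i) \<le> \<delta>)}.
        \<Sum>i. ennreal (diameter (U i)))"

definition hausdorff1 :: "'a::metric_space set \<Rightarrow> ennreal" where
  "hausdorff1 S = (SUP \<delta> \<in> {0<..}. hausdorff1_pre \<delta> S)"

definition steiner_set :: "'a::euclidean_space set \<Rightarrow> 'a set \<Rightarrow> bool" where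
  "steiner_set A S \<longleftrightarrow>
     closed S \<and> connected (S \<union> A) \<and>
     (\<forall>S'. connected (S' \<union> A) \<longrightarrow> hausdorff1 S \<le> hausdorff1 S')"

definition steiner_tree :: "'a::euclidean_space set \<Rightarrow> 'a set \<Rightarrow> bool" where
  "steiner_tree A S \<longleftrightarrow> steiner_set A S \<and> connected S"

(* Each endpoint may or may not belong to the segment.  The degenerate case a = b is allowed:
   it is needed when A is empty, where a single point is a Steiner tree. *)
definition line_segment :: "'a::euclidean_space set \<Rightarrow> bool" where
  "line_segment T \<longleftrightarrow> (\<exists>a b. open_segment a b \<subseteq> T \<and> T \<subseteq> closed_segment a b)"

(* A nondegenerate segment from y (included) to p (included or not). *)
definition segment_from :: "'a::euclidean_space \<Rightarrow> 'a \<Rightarrow> 'a set \<Rightarrow> bool" where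
  "segment_from y p T \<longleftrightarrow>
     p \<noteq> y \<and> closed_segment y p - {p} \<subseteq> T \<and> T \<subseteq> closed_segment y p"

definition vec_angle :: "'a::euclidean_space \<Rightarrow> 'a \<Rightarrow> real" where
  "vec_angle u v = arccos (inner u v / (norm u * norm v))"

definition regular_tripod :: "'a::euclidean_space \<Rightarrow> 'a set \<Rightarrow> bool" where
  "regular_tripod y T \<longleftrightarrow>
     (\<exists>p q r P Q R.
        segment_from y p P \<and> segment_from y q Q \<and> segment_from y r R \<and>
        T = P \<union> Q \<union> R \<and> coplanar {y, p, q, r} \<and>
        vec_angle (p - y) (q - y) = 2 * pi / 3 \<and>
        vec_angle (q - y) (r - y) = 2 * pi / 3 \<and>
        vec_angle (r - y) (p - y) = 2 * pi / 3)"

(* Only branching points off A are considered; a ball disjoint from A contains no others. *)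
definition branching_points :: "'a::euclidean_space set \<Rightarrow> 'a set \<Rightarrow> 'a set" where
  "branching_points A S =
     {y \<in> S - A. \<exists>\<epsilon>0>0. \<forall>\<epsilon>. 0 < \<epsilon> \<and> \<epsilon> < \<epsilon>0 \<longrightarrow> regular_tripod y (S \<inter> ball y \<epsilon>)}"

end

theory Submission
  imports Defs
begin

text \<open>
  Let \<open>d = q + 1\<close> be the dimension.  For \<open>t < s\<close> let \<open>n(t)\<close> be the number of points of \<open>S\<close> on the sphere
  of radius \<open>t\<close> around \<open>x\<close>, and \<open>\<phi>(t)\<close> the length of \<open>S\<close> inside that sphere.  Two estimates for these
  quantities work against each other.

  The points on the sphere can be joined by a connected set of length at most \<open>20 t n(t) powr (1 - 1/q)\<close>,
  because among \<open>n\<close> points on a \<open>q\<close>-dimensional sphere two have distance of order \<open>n powr (- 1/q)\<close>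
  (\<open>connect_points_on_sphere\<close>).  Exchanging the part of \<open>S\<close> in the ball for such a set keeps \<open>S \<union> A\<close>
  connected (\<open>connected_replace_part\<close>), so by minimality \<open>\<phi>(t)\<close> is at most that length
  (\<open>steiner_set_isoperimetric\<close>).

  On the other hand \<open>\<phi>\<close> grows at least at rate \<open>n\<close> (Eilenberg's inequality,
  \<open>hausdorff1_ge_level_count\<close>).  Together this is the differential inequality
  \<open>\<phi>' \<ge> (\<phi> / (20 s)) powr (q / (q - 1))\<close>, whose exponent exceeds 1, so that large solutions blow up
  before \<open>t = s\<close>.  As \<open>\<phi>\<close> is bounded, some radius \<open>t\<close> between \<open>\<rho> s\<close> and \<open>s\<close> has at most
  \<open>(120 q / (1 - \<rho>)) ^ q\<close> points on its sphere (\<open>radius_with_few_points\<close>).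

  At such a radius every component of \<open>S\<close> in the closed ball is a shortest continuum through its finitely
  many points on the sphere.  Continua of finite length are path connected, so arcs inside the component
  form a finite tree joining these points; replacing each arc by its chord does not increase the length,
  hence by minimality the arcs already are segments and fill the component
  (\<open>shortest_continuum_is_union_of_segments\<close>).  For \<open>n\<close> points the tree has at most \<open>2 n\<close> edges and
  \<open>2 n\<close> vertices.  Branching points are vertices, because around any other point a union of segments
  is symmetric, which a tripod is not (\<open>branching_points_are_endpoints\<close>).  The factor 2 is absorbed by
  \<open>2 \<le> (1 + 1/q) ^ q\<close>, which turns \<open>q\<close> into \<open>d\<close>.
\<close>

section \<open>One-dimensional Hausdorff measure\<close>

lemma hausdorff1_pre_le:
  assumes "S \<subseteq> (\<Union>i. U i)" "\<And>i. bounded (U i)" "\<And>i. diameter (U i) \<le> \<delta>"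
  shows "hausdorff1_pre \<delta> S \<le> (\<Sum>i. ennreal (diameter (U i)))"
  unfolding hausdorff1_pre_def by (rule INF_lower) (use assms in auto)

lemma hausdorff1_pre_cover:
  assumes "hausdorff1_pre \<delta> S < c"
  obtains U :: "nat \<Rightarrow> _ set" where "S \<subseteq> (\<Union>i. U i)" "\<And>i. bounded (U i)" "\<And>i. diameter (U i) \<le> \<delta>"
    "(\<Sum>i. ennreal (diameter (U i))) < c"
  using assms unfolding hausdorff1_pre_def INF_less_iff by blast

lemma hausdorff1_pre_mono: "S \<subseteq> T \<Longrightarrow> hausdorff1_pre \<delta> S \<le> hausdorff1_pre \<delta> T"
  unfolding hausdorff1_pre_def by (rule INF_superset_mono) auto

lemma hausdorff1_pre_antimono: "\<delta> \<le> \<epsilon> \<Longrightarrow> hausdorff1_pre \<epsilon> S \<le> hausdorff1_pre \<delta> S"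
  unfolding hausdorff1_pre_def by (rule INF_superset_mono) (auto intro: order_trans)

lemma hausdorff1_pre_le_hausdorff1: "0 < \<delta> \<Longrightarrow> hausdorff1_pre \<delta> S \<le> hausdorff1 S"
  unfolding hausdorff1_def by (rule SUP_upper) auto

lemma hausdorff1_mono: "S \<subseteq> T \<Longrightarrow> hausdorff1 S \<le> hausdorff1 T"
  unfolding hausdorff1_def by (intro SUP_mono) (auto intro: hausdorff1_pre_mono)

lemma hausdorff1_leI:
  assumes "\<And>\<delta>. 0 < \<delta> \<Longrightarrow> hausdorff1_pre \<delta> S \<le> c"
  shows "hausdorff1 S \<le> c"
  unfolding hausdorff1_def by (rule SUP_least) (use assms in auto)

lemma hausdorff1_singleton [simp]: "hausdorff1 {x} = 0"
proof -
  have "hausdorff1_pre \<delta> {x} \<le> 0" if "\<delta> > 0" for \<delta>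
    using hausdorff1_pre_le[of "{x}" "\<lambda>_. {x}" \<delta>] that by simp
  then have "hausdorff1 {x} \<le> 0" by (rule hausdorff1_leI)
  then show ?thesis by simp
qed

lemma hausdorff1_empty [simp]: "hausdorff1 ({} :: 'a::metric_space set) = 0"
proof -
  have "hausdorff1 ({} :: 'a set) \<le> hausdorff1 {undefined :: 'a}" by (rule hausdorff1_mono) simp
  then show ?thesis by simp
qed

lemma hausdorff1_pre_countably_subadditive:
  fixes A :: "nat \<Rightarrow> 'a::metric_space set"
  shows "hausdorff1_pre \<delta> (\<Union>i. A i) \<le> (\<Sum>i. hausdorff1_pre \<delta> (A i))"
proof (rule ennreal_le_epsilon)
  fix e :: real assume fin: "(\<Sum>i. hausdorff1_pre \<delta> (A i)) < top" and e: "0 < e"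
  have finA: "hausdorff1_pre \<delta> (A i) < top" for i
    by (rule le_less_trans[OF _ fin])
       (use sum_le_suminf[of "\<lambda>i. hausdorff1_pre \<delta> (A i)" "{i}"] in auto)
  have "\<exists>U :: nat \<Rightarrow> 'a set. A i \<subseteq> (\<Union>j. U j) \<and> (\<forall>j. bounded (U j) \<and> diameter (U j) \<le> \<delta>) \<and>
     (\<Sum>j. ennreal (diameter (U j))) \<le> hausdorff1_pre \<delta> (A i) + ennreal (e * (1/2) ^ Suc i)" for i
  proof -
    have "hausdorff1_pre \<delta> (A i) < hausdorff1_pre \<delta> (A i) + ennreal (e * (1/2) ^ Suc i)"
      using finA[of i] e
      by (cases "hausdorff1_pre \<delta> (A i)" rule: ennreal_cases)
         (simp_all add: ennreal_plus[symmetric] ennreal_less_iff del: ennreal_plus)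
    then show ?thesis by (elim hausdorff1_pre_cover) (metis order.strict_implies_order)
  qed
  then obtain U where U: "\<And>i. A i \<subseteq> (\<Union>j. U i j)" "\<And>i j. bounded (U i j)"
      "\<And>i j. diameter (U i j) \<le> \<delta>"
      "\<And>i. (\<Sum>j. ennreal (diameter (U i j))) \<le> hausdorff1_pre \<delta> (A i) + ennreal (e * (1/2) ^ Suc i)"
    by metis
  define W where "W n = case_prod U (prod_decode n)" for n
  have cov: "(\<Union>i. A i) \<subseteq> (\<Union>n. W n)"
  proof
    fix x assume "x \<in> (\<Union>i. A i)"
    then obtain i j where "x \<in> U i j" using U(1) by blast
    then have "x \<in> W (prod_encode (i, j))" by (simp add: W_def)
    then show "x \<in> (\<Union>n. W n)" by blast
  qed
  have "hausdorff1_pre \<delta> (\<Union>i. A i) \<le> (\<Sum>n. ennreal (diameter (W n)))"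
    by (rule hausdorff1_pre_le[OF cov]) (auto simp: W_def U split: prod.split)
  also have "\<dots> = (\<Sum>i. \<Sum>j. ennreal (diameter (U i j)))"
    using suminf_ennreal_2dimen[of "\<lambda>i. \<Sum>j. ennreal (diameter (U i j))" "\<lambda>(i,j). ennreal (diameter (U i j))"]
    by (simp add: W_def comp_def case_prod_unfold)
  also have "\<dots> \<le> (\<Sum>i. hausdorff1_pre \<delta> (A i) + ennreal (e * (1/2) ^ Suc i))"
    by (intro suminf_le U) auto
  also have "\<dots> = (\<Sum>i. hausdorff1_pre \<delta> (A i)) + (\<Sum>i. ennreal (e * (1/2) ^ Suc i))"
    by (rule suminf_add[symmetric]) auto
  also have "(\<Sum>i. ennreal (e * (1/2) ^ Suc i)) = ennreal e"
  proof (rule suminf_ennreal_eq)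
    show "(\<lambda>i. e * (1/2) ^ Suc i) sums e"
      using sums_mult[OF power_half_series, of e] by simp
  qed (use e in auto)
  finally show "hausdorff1_pre \<delta> (\<Union>i. A i) \<le> (\<Sum>i. hausdorff1_pre \<delta> (A i)) + ennreal e" .
qed

lemma hausdorff1_countably_subadditive:
  fixes A :: "nat \<Rightarrow> 'a::metric_space set"
  shows "hausdorff1 (\<Union>i. A i) \<le> (\<Sum>i. hausdorff1 (A i))"
proof (rule hausdorff1_leI)
  fix \<delta> :: real assume "0 < \<delta>"
  then have "(\<Sum>i. hausdorff1_pre \<delta> (A i)) \<le> (\<Sum>i. hausdorff1 (A i))"
    by (intro suminf_le hausdorff1_pre_le_hausdorff1) auto
  then show "hausdorff1_pre \<delta> (\<Union>i. A i) \<le> (\<Sum>i. hausdorff1 (A i))"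
    using hausdorff1_pre_countably_subadditive order_trans by blast
qed

lemma hausdorff1_Un_le: "hausdorff1 (S \<union> T) \<le> hausdorff1 S + hausdorff1 T"
proof -
  define A where "A n = (if n = 0 then S else if n = Suc 0 then T else {})" for n :: nat
  have "S \<union> T = (\<Union>i. A i)" by (auto simp: A_def split: if_splits)
  then have "hausdorff1 (S \<union> T) \<le> (\<Sum>i. hausdorff1 (A i))"
    using hausdorff1_countably_subadditive[of A] by simp
  also have "\<dots> = (\<Sum>i\<in>{0, Suc 0}. hausdorff1 (A i))"
    by (rule suminf_finite) (auto simp: A_def)
  also have "\<dots> = hausdorff1 S + hausdorff1 T" by (simp add: A_def)
  finally show ?thesis .
qed

lemma hausdorff1_UN_le:
  "finite I \<Longrightarrow> hausdorff1 (\<Union>i\<in>I. A i) \<le> (\<Sum>i\<in>I. hausdorff1 (A i))"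
proof (induction rule: finite_induct)
  case (insert i I)
  have "hausdorff1 (\<Union>i\<in>insert i I. A i) \<le> hausdorff1 (A i) + hausdorff1 (\<Union>i\<in>I. A i)"
    using hausdorff1_Un_le[of "A i" "\<Union>i\<in>I. A i"] by simp
  also have "\<dots> \<le> hausdorff1 (A i) + (\<Sum>i\<in>I. hausdorff1 (A i))"
    by (intro add_left_mono insert.IH)
  finally show ?case using insert.hyps by simp
qed simp

lemma hausdorff1_finite: "finite V \<Longrightarrow> hausdorff1 V = 0"
  using hausdorff1_UN_le[of V "\<lambda>v. {v}"] by simp

text \<open>A covering set of diameter at most \<open>\<delta>\<close> cannot meet both of two sets that are more than \<open>\<delta>\<close>
  apart, so a cover of the union splits into covers of the two sets.\<close>

lemma hausdorff1_pre_Un_separated: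
  fixes S T :: "'a::metric_space set"
  assumes sep: "\<And>x y. x \<in> S \<Longrightarrow> y \<in> T \<Longrightarrow> \<delta> < dist x y" and "0 < \<delta>"
  shows "hausdorff1_pre \<delta> S + hausdorff1_pre \<delta> T \<le> hausdorff1_pre \<delta> (S \<union> T)"
proof -
  have "hausdorff1_pre \<delta> S + hausdorff1_pre \<delta> T \<le> (\<Sum>i. ennreal (diameter (U i)))"
    if U: "S \<union> T \<subseteq> (\<Union>i. U i)" "\<And>i. bounded (U i)" "\<And>i. diameter (U i) \<le> \<delta>" for U :: "nat \<Rightarrow> 'a set"
  proof -
    define US where "US i = (if U i \<inter> S = {} then {} else U i)" for i
    define UT where "UT i = (if U i \<inter> T = {} then {} else U i)" for i
    have disj: "U i \<inter> S = {} \<or> U i \<inter> T = {}" for i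
    proof (rule ccontr)
      assume "\<not> ?thesis"
      then obtain x y where "x \<in> U i" "x \<in> S" "y \<in> U i" "y \<in> T" by blast
      then show False
        using diameter_bounded_bound[OF U(2)[of i], of x y] U(3)[of i] sep[of x y] by simp
    qed
    have 1: "hausdorff1_pre \<delta> S \<le> (\<Sum>i. ennreal (diameter (US i)))"
      by (rule hausdorff1_pre_le) (use U \<open>0 < \<delta>\<close> in \<open>fastforce simp: US_def\<close>)+
    have 2: "hausdorff1_pre \<delta> T \<le> (\<Sum>i. ennreal (diameter (UT i)))"
      by (rule hausdorff1_pre_le) (use U \<open>0 < \<delta>\<close> in \<open>fastforce simp: UT_def\<close>)+
    have "(\<Sum>i. ennreal (diameter (US i))) + (\<Sum>i. ennreal (diameter (UT i)))
        = (\<Sum>i. ennreal (diameter (US i)) + ennreal (diameter (UT i)))"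
      by (rule suminf_add) auto
    also have "\<dots> \<le> (\<Sum>i. ennreal (diameter (U i)))"
      by (rule suminf_le) (use disj in \<open>auto simp: US_def UT_def\<close>)
    finally show ?thesis using add_mono[OF 1 2] by order
  qed
  then show ?thesis
    unfolding hausdorff1_pre_def[of \<delta> "S \<union> T"] by (intro INF_greatest) auto
qed

lemma hausdorff1_Un_separated:
  fixes S T :: "'a::metric_space set"
  assumes sep: "\<And>x y. x \<in> S \<Longrightarrow> y \<in> T \<Longrightarrow> \<eta> \<le> dist x y" and "0 < \<eta>"
  shows "hausdorff1 S + hausdorff1 T \<le> hausdorff1 (S \<union> T)"
proof -
  have "hausdorff1_pre \<delta> S + hausdorff1_pre \<delta>' T \<le> hausdorff1 (S \<union> T)" if "0 < \<delta>" "0 < \<delta>'" for \<delta> \<delta>'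
  proof -
    define \<gamma> where "\<gamma> = min (\<eta>/2) (min \<delta> \<delta>')"
    have \<gamma>: "0 < \<gamma>" "\<gamma> < \<eta>" "\<gamma> \<le> \<delta>" "\<gamma> \<le> \<delta>'" using that assms by (auto simp: \<gamma>_def)
    have "hausdorff1_pre \<delta> S + hausdorff1_pre \<delta>' T \<le> hausdorff1_pre \<gamma> S + hausdorff1_pre \<gamma> T"
      by (intro add_mono hausdorff1_pre_antimono \<gamma>)
    also have "\<dots> \<le> hausdorff1_pre \<gamma> (S \<union> T)"
      using \<gamma> sep by (intro hausdorff1_pre_Un_separated) (auto intro: less_le_trans)
    also have "\<dots> \<le> hausdorff1 (S \<union> T)" by (rule hausdorff1_pre_le_hausdorff1) fact
    finally show ?thesis .
  qed
  note * = this
  have **: "hausdorff1 S + hausdorff1_pre \<delta>' T \<le> hausdorff1 (S \<union> T)" if "0 < \<delta>'" for \<delta>'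
    unfolding hausdorff1_def[of S] using *[OF _ that]
    by (subst ennreal_SUP_add_left[symmetric]) (auto intro!: SUP_least)
  show ?thesis
    unfolding hausdorff1_def[of T] using **
    by (subst ennreal_SUP_add_right) (auto intro!: SUP_least)
qed

text \<open>Caratheodory's criterion for a closed set \<open>C\<close>.  The part of \<open>X\<close> at distance at least \<open>1/n\<close>
  from \<open>C\<close> is separated from \<open>X \<inter> C\<close>, so only the measure of the remaining layer around \<open>C\<close> has to
  be shown to vanish as \<open>n\<close> grows.  The shells \<open>R k\<close> that make up that layer are separated from one
  another if one skips every second one, hence the sum of their measures is at most twice the measure
  of \<open>X\<close>, and its tails tend to 0.\<close>

lemma hausdorff1_split:
  fixes X C :: "'a::metric_space set"
  assumes "closed C"
  shows "hausdorff1 X = hausdorff1 (X \<inter> C) + hausdorff1 (X - C)"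
proof (rule antisym)
  have "X = (X \<inter> C) \<union> (X - C)" by blast
  then show "hausdorff1 X \<le> hausdorff1 (X \<inter> C) + hausdorff1 (X - C)"
    by (metis hausdorff1_Un_le)
next
  show "hausdorff1 (X \<inter> C) + hausdorff1 (X - C) \<le> hausdorff1 X"
  proof (cases "C = {} \<or> hausdorff1 X = top")
    case True
    then show ?thesis by auto
  next
    case False
    then have ne: "C \<noteq> {}" and fin: "hausdorff1 X \<noteq> top" by auto
    define g where "g x = infdist x C" for x
    have lip: "\<bar>g x - g y\<bar> \<le> dist x y" for x y
      using infdist_triangle_abs[of x C y] by (simp add: g_def)
    have g0: "g x = 0" if "x \<in> C" for x using that by (simp add: g_def)
    have gpos: "g x > 0" if "x \<notin> C" for x
      using that assms ne by (simp add: g_def infdist_pos_not_in_closed)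
    define D where "D n = {x \<in> X. 1 / Suc n \<le> g x}" for n
    \<comment> \<open>\<open>D n\<close> is the part of \<open>X\<close> away from \<open>C\<close>, and the shells \<open>R k\<close> with \<open>k \<ge> n\<close> make up the rest of \<open>X - C\<close>\<close>
    define R where "R k = {x \<in> X. 1 / Suc (Suc k) \<le> g x \<and> g x < 1 / Suc k}" for k
    have Dsub: "D n \<subseteq> X - C" for n
    proof
      fix x assume x: "x \<in> D n"
      then have "0 < g x" unfolding D_def by (auto intro: less_le_trans[of 0 "1 / (1 + real n)"])
      then show "x \<in> X - C" using x g0[of x] by (auto simp: D_def)
    qed
    have 1: "hausdorff1 (X \<inter> C) + hausdorff1 (D n) \<le> hausdorff1 X" for n
    proof -
      have "hausdorff1 (X \<inter> C) + hausdorff1 (D n) \<le> hausdorff1 ((X \<inter> C) \<union> D n)"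
      proof (rule hausdorff1_Un_separated[where \<eta> = "1 / Suc n"])
        fix x y assume "x \<in> X \<inter> C" "y \<in> D n"
        then show "1 / real (Suc n) \<le> dist x y"
          using lip[of x y] g0[of x] by (auto simp: D_def)
      qed simp
      also have "\<dots> \<le> hausdorff1 X" using Dsub by (intro hausdorff1_mono) auto
      finally show ?thesis .
    qed
    \<comment> \<open>\<open>p\<close> is the parity of the shells; the gap shrinks with \<open>n\<close>, but it only has to be positive\<close>
    have sepR: "(\<Sum>i<n. hausdorff1 (R (2 * i + p))) \<le> hausdorff1 (\<Union>i<n. R (2 * i + p))" for n p
    proof (induction n)
      case (Suc n)
      have "(\<Sum>i<Suc n. hausdorff1 (R (2 * i + p)))
          \<le> hausdorff1 (\<Union>i<n. R (2 * i + p)) + hausdorff1 (R (2 * n + p))"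
        using Suc by (simp add: add_right_mono)
      also have "\<dots> \<le> hausdorff1 ((\<Union>i<n. R (2 * i + p)) \<union> R (2 * n + p))"
      proof (rule hausdorff1_Un_separated)
        let ?\<eta> = "1 / real (2 * n + p) - 1 / real (Suc (2 * n + p))"
        show "0 < (if n = 0 then 1 else ?\<eta>)"
          using divide_strict_left_mono[of "real (2 * n + p)" "real (Suc (2 * n + p))" 1] by auto
        fix x y assume x: "x \<in> (\<Union>i<n. R (2 * i + p))" and y: "y \<in> R (2 * n + p)"
        then obtain i where i: "i < n" "x \<in> R (2 * i + p)" by blast
        have "1 / real (2 * n + p) \<le> 1 / Suc (Suc (2 * i + p))"
          using i(1) by (intro divide_left_mono) auto
        also have "\<dots> \<le> g x" using i(2) by (simp add: R_def)
        finally have "?\<eta> \<le> g x - g y" using y by (auto simp: R_def)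
        then show "(if n = 0 then 1 else ?\<eta>) \<le> dist x y" using lip[of x y] i(1) by auto
      qed
      also have "(\<Union>i<n. R (2 * i + p)) \<union> R (2 * n + p) = (\<Union>i<Suc n. R (2 * i + p))"
        by (auto simp: lessThan_Suc)
      finally show ?case .
    qed simp
    have sub: "(\<Union>i\<in>I. R (f i)) \<subseteq> X" for I :: "nat set" and f by (auto simp: R_def)
    have bnd: "(\<Sum>i<n. hausdorff1 (R (2 * i + p))) \<le> hausdorff1 X" for n p
      using sepR[where n = n and p = p] hausdorff1_mono[OF sub[of "\<lambda>i. 2 * i + p" "{..<n}"]] by (rule order_trans)
    have "(\<Sum>k<2*n. hausdorff1 (R k))
        = (\<Sum>i<n. hausdorff1 (R (2 * i + 0))) + (\<Sum>i<n. hausdorff1 (R (2 * i + 1)))" for n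
      by (induction n) (auto simp: algebra_simps)
    then have bnd2: "(\<Sum>k<2*n. hausdorff1 (R k)) \<le> hausdorff1 X + hausdorff1 X" for n
      using add_mono[OF bnd[where n = n and p = 0] bnd[where n = n and p = 1]] by metis
    have "(\<Sum>k<n. hausdorff1 (R k)) \<le> hausdorff1 X + hausdorff1 X" for n
      by (rule order_trans[OF _ bnd2[of n]]) (auto intro!: sum_mono2)
    then have "(\<Sum>k. hausdorff1 (R k)) \<le> hausdorff1 X + hausdorff1 X"
      by (simp add: suminf_eq_SUP SUP_least)
    then have finR: "(\<Sum>k. hausdorff1 (R k)) \<noteq> top"
      using fin by (metis ennreal_add_eq_top neq_top_trans)
    have tail: "(\<lambda>n. \<Sum>k. hausdorff1 (R (k + n))) \<longlonglongrightarrow> 0"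
    proof -
      define r where "r k = enn2real (hausdorff1 (R k))" for k
      have "hausdorff1 (R k) \<noteq> top" for k
        using fin hausdorff1_mono[of "R k" X] by (auto simp: R_def top_unique)
      then have eq: "hausdorff1 (R k) = ennreal (r k)" for k
        by (simp add: r_def less_top)
      have r0: "0 \<le> r k" for k by (simp add: r_def)
      have sm: "summable r"
        using finR by (intro summable_suminf_not_top) (auto simp: eq r0)
      have "(\<lambda>n. \<Sum>k. r (k + n)) \<longlonglongrightarrow> 0"
        using suminf_exist_split2[OF sm] .
      moreover have "(\<Sum>k. hausdorff1 (R (k + n))) = ennreal (\<Sum>k. r (k + n))" for n
        unfolding eq using sm by (intro suminf_ennreal2) (auto simp: r0 summable_iff_shift)
      ultimately show ?thesis using tendsto_ennrealI by fastforce
    qed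
    have layer: "hausdorff1 (X - C) \<le> hausdorff1 (D n) + (\<Sum>k. hausdorff1 (R (k + n)))" for n
    proof -
      have "X - C \<subseteq> D n \<union> (\<Union>k. R (k + n))"
      proof
        fix x assume x: "x \<in> X - C"
        then have "0 < g x" using gpos by auto
        then obtain N where N: "1 / Suc N < g x" using nat_approx_posE by blast
        define m where "m = (LEAST m. 1 / Suc m \<le> g x)"
        have m: "1 / Suc m \<le> g x" unfolding m_def by (rule LeastI[of _ N]) (use N in simp)
        have m': "g x < 1 / Suc j" if "j < m" for j
          using not_less_Least[of j "\<lambda>m. 1 / Suc m \<le> g x"] that by (simp add: m_def)
        show "x \<in> D n \<union> (\<Union>k. R (k + n))"
        proof (cases "m \<le> n")
          case True
          then have "1 / Suc n \<le> 1 / Suc m" by (simp add: field_simps)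
          then show ?thesis using x m by (auto simp: D_def)
        next
          case False
          then have "x \<in> R ((m - 1 - n) + n)" using x m m'[of "m - 1"] by (simp add: R_def)
          then show ?thesis by blast
        qed
      qed
      then have "hausdorff1 (X - C) \<le> hausdorff1 (D n \<union> (\<Union>k. R (k + n)))" by (rule hausdorff1_mono)
      also have "\<dots> \<le> hausdorff1 (D n) + hausdorff1 (\<Union>k. R (k + n))" by (rule hausdorff1_Un_le)
      also have "\<dots> \<le> hausdorff1 (D n) + (\<Sum>k. hausdorff1 (R (k + n)))"
        by (intro add_left_mono hausdorff1_countably_subadditive)
      finally show ?thesis .
    qed
    have "hausdorff1 (X \<inter> C) + hausdorff1 (X - C) \<le> hausdorff1 X + (\<Sum>k. hausdorff1 (R (k + n)))" for n
      using add_left_mono[OF layer[of n], of "hausdorff1 (X \<inter> C)"] add_right_mono[OF 1[of n]]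
      by (metis (no_types, lifting) add.assoc order_trans)
    moreover have "(\<lambda>n. hausdorff1 X + (\<Sum>k. hausdorff1 (R (k + n)))) \<longlonglongrightarrow> hausdorff1 X + 0"
      by (intro tendsto_add tendsto_const tail)
    ultimately show ?thesis
      using LIMSEQ_le_const[of _ "hausdorff1 X + 0" "hausdorff1 (X \<inter> C) + hausdorff1 (X - C)"] by auto
  qed
qed

text \<open>The additivity that is used for gluing arcs at a common point: the point has measure 0.\<close>

lemma hausdorff1_add_le:
  assumes "closed C" "C \<subseteq> X" "D \<subseteq> X" "C \<inter> D \<subseteq> {w}"
  shows "hausdorff1 C + hausdorff1 D \<le> hausdorff1 X"
proof -
  have "hausdorff1 D \<le> hausdorff1 ({w} \<union> (D - C))" using assms(4) by (intro hausdorff1_mono) auto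
  also have "\<dots> \<le> hausdorff1 (X - C)"
    using hausdorff1_Un_le[of "{w}" "D - C"] hausdorff1_mono[of "D - C" "X - C"] assms(3)
    by (auto intro: order_trans)
  finally show ?thesis
    using hausdorff1_split[OF assms(1), of X] assms(2) by (simp add: Int_absorb1 add_left_mono)
qed

lemma hausdorff1_closed_segment_le:
  fixes a b :: "'a::euclidean_space"
  shows "hausdorff1 (closed_segment a b) \<le> ennreal (dist a b)"
proof (rule hausdorff1_leI)
  fix \<delta> :: real assume "0 < \<delta>"
  obtain N where N: "dist a b / \<delta> < real N" using reals_Archimedean2 by blast
  define h where "h t = a + t *\<^sub>R (b - a)" for t :: real
  have N0: "N > 0" using N \<open>0 < \<delta>\<close> by (cases N) (auto simp: field_simps not_less)
  define U where "U i = (if i < N then h ` {real i / N .. real (Suc i) / N} else {})" for i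
  have seg: "closed_segment a b = h ` {0..1}"
    unfolding h_def closed_segment_def by (auto simp: algebra_simps image_def)
  have dh: "norm (h t - h t') = \<bar>t - t'\<bar> * dist a b" for t t'
  proof -
    have "h t - h t' = (t - t') *\<^sub>R (b - a)" by (simp add: h_def algebra_simps)
    then show ?thesis by (simp add: dist_norm norm_minus_commute)
  qed
  have diam: "diameter (U i) \<le> (if i < N then dist a b / N else 0)" for i
  proof -
    have "norm (h t - h t') \<le> dist a b / N"
      if "t \<in> {real i / N .. real (Suc i) / N}" "t' \<in> {real i / N .. real (Suc i) / N}" for t t'
    proof -
      have "\<bar>t - t'\<bar> \<le> 1 / N" using that by (auto simp: abs_le_iff add_divide_distrib)
      then show ?thesis unfolding dh using mult_right_mono[of "\<bar>t - t'\<bar>" "1 / N" "dist a b"] by simp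
    qed
    then show ?thesis by (auto simp: U_def intro!: diameter_le)
  qed
  have bd: "bounded (U i)" for i
    unfolding U_def h_def by (auto intro!: compact_imp_bounded compact_continuous_image continuous_intros)
  have small: "dist a b / N \<le> \<delta>" using N N0 \<open>0 < \<delta>\<close> by (simp add: field_simps)
  have cov: "closed_segment a b \<subseteq> (\<Union>i. U i)"
  proof
    fix x assume "x \<in> closed_segment a b"
    then obtain t where t: "0 \<le> t" "t \<le> 1" "x = h t" by (auto simp: seg)
    show "x \<in> (\<Union>i. U i)"
    proof (cases "t = 1")
      case True
      have "x \<in> U (N - 1)" using N0 t True by (auto simp: U_def of_nat_diff field_simps intro!: imageI)
      then show ?thesis by blast
    next
      case False
      define i where "i = nat \<lfloor>t * N\<rfloor>"
      have i: "real i \<le> t * N" "t * N < real i + 1" using t N0 by (auto simp: i_def)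
      have "t * real N < 1 * real N" using False t N0 by (intro mult_strict_right_mono) auto
      then have "i < N" using i(1) by linarith
      moreover have "t \<in> {real i / N .. real (Suc i) / N}" using i N0 by (auto simp: field_simps)
      ultimately have "x \<in> U i" using t by (auto simp: U_def)
      then show ?thesis by blast
    qed
  qed
  have "hausdorff1_pre \<delta> (closed_segment a b) \<le> (\<Sum>i. ennreal (diameter (U i)))"
    using cov bd by (rule hausdorff1_pre_le)
      (use diam small \<open>0 < \<delta>\<close> in \<open>smt (verit, best) zero_le_dist divide_nonneg_nonneg of_nat_0_le_iff\<close>)
  also have "\<dots> = (\<Sum>i<N. ennreal (diameter (U i)))"
    by (rule suminf_finite) (auto simp: U_def)
  also have "\<dots> \<le> (\<Sum>i<N. ennreal (dist a b / N))"
    by (intro sum_mono ennreal_leI) (metis diam lessThan_iff)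
  also have "\<dots> = ennreal (dist a b)" using N0
    by (subst sum_ennreal) auto
  finally show "hausdorff1_pre \<delta> (closed_segment a b) \<le> ennreal (dist a b)" .
qed

section \<open>Length bounds from level sets\<close>

text \<open>Eilenberg's inequality for a constant lower bound on the number of points in each level set.
  The image under \<open>f\<close> of a covering set \<open>U\<close> lies in an interval \<open>J\<close> that is no longer than the
  diameter of \<open>U\<close>, hence the integral of the number \<open>h k r\<close> of intervals that contain \<open>r\<close> is bounded
  by the sum of the diameters.  Once the mesh \<open>1 / (k + 1)\<close> of the cover is smaller than the distances
  between \<open>m\<close> points at level \<open>r\<close>, these points lie in different covering sets, so that
  \<open>h k r \<ge> m\<close>.  Fatou's lemma passes to the limit.\<close>

lemma hausdorff1_ge_level_count:
  fixes f :: "'a::metric_space \<Rightarrow> real"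
  assumes lip: "\<And>x y. x \<in> E \<Longrightarrow> y \<in> E \<Longrightarrow> \<bar>f x - f y\<bar> \<le> dist x y"
    and many: "\<And>r. a < r \<Longrightarrow> r < b \<Longrightarrow> \<exists>P\<subseteq>E. finite P \<and> m \<le> card P \<and> (\<forall>p\<in>P. f p = r)"
    and "a \<le> b"
  shows "ennreal (real m * (b - a)) \<le> hausdorff1 E"
proof (cases "hausdorff1 E = top")
  case False
  have "\<exists>U :: nat \<Rightarrow> 'a set. E \<subseteq> (\<Union>i. U i) \<and> (\<forall>i. bounded (U i) \<and> diameter (U i) \<le> 1 / Suc k) \<and>
     (\<Sum>i. ennreal (diameter (U i))) \<le> hausdorff1 E + ennreal (1 / Suc k)" for k
  proof -
    have "hausdorff1_pre (1 / Suc k) E \<le> hausdorff1 E" by (rule hausdorff1_pre_le_hausdorff1) simp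
    also have "\<dots> < hausdorff1 E + ennreal (1 / Suc k)"
      using False by (cases "hausdorff1 E" rule: ennreal_cases)
        (simp_all add: ennreal_plus[symmetric] ennreal_less_iff del: ennreal_plus)
    finally show ?thesis by (elim hausdorff1_pre_cover) (metis order.strict_implies_order)
  qed
  then obtain U where U: "\<And>k. E \<subseteq> (\<Union>i. U k i)" "\<And>k i. bounded (U k i)"
      "\<And>k i. diameter (U k i) \<le> 1 / Suc k"
      "\<And>k. (\<Sum>i. ennreal (diameter (U k i))) \<le> hausdorff1 E + ennreal (1 / Suc k)"
    by metis
  define Y where "Y k i = f ` (U k i \<inter> E)" for k i
  define J where "J k i = (if Y k i = {} then {} else {Inf (Y k i)..Sup (Y k i)})" for k i :: nat
  have width: "y \<le> y' + diameter (U k i)" if "y \<in> Y k i" "y' \<in> Y k i" for y y' k i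
    using that lip diameter_bounded_bound[OF U(2)[of k i]] by (fastforce simp: Y_def)
  have bdd: "bdd_above (Y k i)" "bdd_below (Y k i)" for k i
  proof -
    have "bdd_above (Y k i) \<and> bdd_below (Y k i)"
    proof (cases "Y k i = {}")
      case False
      then obtain y where y: "y \<in> Y k i" by blast
      have "bdd_above (Y k i)"
        using width[OF _ y] by (intro bdd_aboveI[of _ "y + diameter (U k i)"]) auto
      moreover have "bdd_below (Y k i)"
        using width[OF y] by (intro bdd_belowI[of _ "y - diameter (U k i)"]) (metis diff_le_eq)
      ultimately show ?thesis ..
    qed simp
    then show "bdd_above (Y k i)" "bdd_below (Y k i)" by auto
  qed
  have J_meas: "J k i \<in> sets borel" for k i by (simp add: J_def)
  have J_len: "emeasure lborel (J k i) \<le> ennreal (diameter (U k i))" for k i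
  proof (cases "Y k i = {}")
    case False
    have "Sup (Y k i) \<le> Inf (Y k i) + diameter (U k i)"
    proof (rule cSup_least[OF False])
      fix y assume y: "y \<in> Y k i"
      have "y - diameter (U k i) \<le> Inf (Y k i)"
        by (rule cInf_greatest[OF False]) (metis diff_le_eq width[OF y])
      then show "y \<le> Inf (Y k i) + diameter (U k i)" by simp
    qed
    moreover have "Inf (Y k i) \<le> Sup (Y k i)" using False bdd by (rule cInf_le_cSup)
    ultimately show ?thesis using False by (simp add: J_def ennreal_leI)
  qed (simp add: J_def)
  have J_mem: "f p \<in> J k i" if "p \<in> E" "p \<in> U k i" for p k i
  proof -
    have "f p \<in> Y k i" using that by (auto simp: Y_def)
    then show ?thesis using bdd[of k i] by (auto simp: J_def intro: cInf_lower cSup_upper)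
  qed
  define h where "h k r = (\<Sum>i. indicator (J k i) r :: ennreal)" for k and r :: real
  have h_meas: "h k \<in> borel_measurable lborel" for k
    unfolding h_def using J_meas by measurable
  have h_int: "(\<integral>\<^sup>+r. h k r \<partial>lborel) \<le> hausdorff1 E + ennreal (1 / Suc k)" for k
  proof -
    have "(\<integral>\<^sup>+r. h k r \<partial>lborel) = (\<Sum>i. \<integral>\<^sup>+r. indicator (J k i) r \<partial>lborel)"
      unfolding h_def using J_meas by (intro nn_integral_suminf) auto
    also have "\<dots> = (\<Sum>i. emeasure lborel (J k i))" using J_meas by simp
    also have "\<dots> \<le> (\<Sum>i. ennreal (diameter (U k i)))" by (intro suminf_le J_len) auto
    finally show ?thesis using U(4) by (rule order_trans)
  qed
  have h_ge: "of_nat m \<le> liminf (\<lambda>k. h k r)" if r: "a < r" "r < b" for r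
  proof -
    obtain P where P: "P \<subseteq> E" "finite P" "m \<le> card P" "\<forall>p\<in>P. f p = r" using many[OF r] by blast
    obtain \<eta> where \<eta>: "\<eta> > 0" "\<And>p q. p \<in> P \<Longrightarrow> q \<in> P \<Longrightarrow> p \<noteq> q \<Longrightarrow> \<eta> \<le> dist p q"
    proof -
      define D where "D = insert 1 ((\<lambda>(p,q). dist p q) ` (P \<times> P - Id))"
      have "finite D" using P(2) by (simp add: D_def)
      moreover have "Min D > 0" using \<open>finite D\<close> by (subst Min_gr_iff) (auto simp: D_def)
      moreover have "Min D \<le> dist p q" if "p \<in> P" "q \<in> P" "p \<noteq> q" for p q
        using \<open>finite D\<close> that by (intro Min_le) (auto simp: D_def)
      ultimately show ?thesis using that by blast
    qed
    obtain N where N: "1 / Suc N < \<eta>" using nat_approx_posE[OF \<eta>(1)] by blast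
    have "of_nat m \<le> h k r" if "N \<le> k" for k
    proof -
      have "\<forall>p\<in>P. \<exists>i. p \<in> U k i" using P(1) U(1)[of k] by blast
      then obtain i where i: "\<And>p. p \<in> P \<Longrightarrow> p \<in> U k (i p)" by metis
      have "1 / Suc k \<le> 1 / Suc N" using that by (simp add: field_simps)
      then have small: "diameter (U k j) < \<eta>" for j using U(3)[of k j] N by linarith
      have inj: "inj_on i P"
      proof (rule inj_onI, rule ccontr)
        fix p q assume pq: "p \<in> P" "q \<in> P" "i p = i q" "p \<noteq> q"
        then have "dist p q \<le> diameter (U k (i p))"
          using i[of p] i[of q] by (intro diameter_bounded_bound U(2)) auto
        then show False using \<eta>(2)[of p q] small[of "i p"] pq by simp
      qed
      have "of_nat m \<le> (of_nat (card P) :: ennreal)" using P(3) by (rule of_nat_mono)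
      also have "\<dots> = (\<Sum>j\<in>i ` P. 1)" using inj by (simp add: card_image)
      also have "\<dots> \<le> (\<Sum>j\<in>i ` P. indicator (J k j) r)"
        using P(1,4) i J_mem by (intro sum_mono) (force simp: indicator_def)
      also have "\<dots> \<le> h k r" unfolding h_def using P(2) by (intro sum_le_suminf) auto
      finally show ?thesis .
    qed
    then show ?thesis
      by (intro Liminf_bounded) (auto simp: eventually_sequentially)
  qed
  have "ennreal (real m * (b - a)) = of_nat m * emeasure lborel {a<..<b}"
    using \<open>a \<le> b\<close> by (simp add: ennreal_mult ennreal_of_nat_eq_real_of_nat)
  also have "\<dots> = (\<integral>\<^sup>+r. of_nat m * indicator {a<..<b} r \<partial>lborel)"
    by (simp add: nn_integral_cmult_indicator)
  also have "\<dots> \<le> (\<integral>\<^sup>+r. liminf (\<lambda>k. h k r) \<partial>lborel)"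
    using h_ge by (intro nn_integral_mono) (auto simp: indicator_def)
  also have "\<dots> \<le> liminf (\<lambda>k. \<integral>\<^sup>+r. h k r \<partial>lborel)"
    by (rule nn_integral_liminf) (rule h_meas)
  also have "\<dots> \<le> liminf (\<lambda>k. hausdorff1 E + ennreal (1 / Suc k))"
    using h_int by (intro Liminf_mono) auto
  also have "\<dots> = hausdorff1 E"
  proof (rule lim_imp_Liminf)
    have "(\<lambda>k. ennreal (1 / Suc k)) \<longlonglongrightarrow> ennreal 0"
      by (intro tendsto_ennrealI LIMSEQ_inverse_real_of_nat[unfolded inverse_eq_divide])
    then show "(\<lambda>k. hausdorff1 E + ennreal (1 / Suc k)) \<longlonglongrightarrow> hausdorff1 E"
      using tendsto_add[OF tendsto_const, of _ "ennreal 0" sequentially "hausdorff1 E"] by simp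
  qed simp
  finally show ?thesis .
qed simp

lemma connected_meets_sphere:
  fixes K :: "'a::metric_space set"
  assumes "connected K" "p \<in> K" "q \<in> K" "dist c p \<le> r" "r \<le> dist c q"
  obtains z where "z \<in> K" "dist c z = r"
proof -
  have "connected (dist c ` K)" using assms(1) by (intro connected_continuous_image continuous_intros)
  then have "{dist c p..dist c q} \<subseteq> dist c ` K" using assms by (intro connected_contains_Icc) auto
  then show ?thesis using assms that by (auto simp: subset_iff image_iff)
qed

text \<open>A connected set that is not contained in a ball around one of its points meets every
  concentric sphere inside that ball.\<close>

lemma hausdorff1_Int_ball_ge:
  fixes K :: "'a::metric_space set"
  assumes "connected K" "p \<in> K" "q \<in> K" "r \<le> dist p q" "0 \<le> r"
  shows "ennreal r \<le> hausdorff1 (K \<inter> ball p r)"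
proof -
  have "ennreal (real 1 * (r - 0)) \<le> hausdorff1 (K \<inter> ball p r)"
  proof (rule hausdorff1_ge_level_count)
    show "\<bar>dist p x - dist p y\<bar> \<le> dist x y" for x y
      using dist_triangle[of p x y] dist_triangle[of p y x] by (simp add: dist_commute)
    fix t assume t: "0 < t" "t < r"
    obtain z where "z \<in> K" "dist p z = t"
      using connected_meets_sphere[of K p q p t] assms t by auto
    then show "\<exists>P\<subseteq>K \<inter> ball p r. finite P \<and> 1 \<le> card P \<and> (\<forall>z\<in>P. dist p z = t)"
      using t by (intro exI[of _ "{z}"]) auto
  qed (rule assms)
  then show ?thesis by simp
qed

lemma hausdorff1_connected_ge_dist:
  fixes K :: "'a::metric_space set"
  assumes "connected K" "p \<in> K" "q \<in> K"
  shows "ennreal (dist p q) \<le> hausdorff1 K"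
  by (rule order_trans[OF hausdorff1_Int_ball_ge[OF assms, of "dist p q"] hausdorff1_mono]) auto

section \<open>Continua of finite length are path connected\<close>

text \<open>In a chain with the least number of links, non-adjacent points are far apart, for otherwise there
  would be a shortcut.\<close>

lemma connected_minimal_chain:
  fixes K :: "'a::metric_space set"
  assumes K: "connected K" and ab: "a \<in> K" "b \<in> K" and \<epsilon>: "0 < \<epsilon>"
  obtains n f where "f 0 = a" "f n = b" "\<And>i. i \<le> n \<Longrightarrow> f i \<in> K"
    "\<And>i. i < n \<Longrightarrow> dist (f i) (f (Suc i)) < \<epsilon>"
    "\<And>i j. i + 2 \<le> j \<Longrightarrow> j \<le> n \<Longrightarrow> \<epsilon> \<le> dist (f i) (f j)"
proof -
  define R where "R = {(x, y). x \<in> K \<and> y \<in> K \<and> dist x y < \<epsilon>}"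
  have sym: "(y, x) \<in> R\<^sup>*" if "(x, y) \<in> R\<^sup>*" for x y
  proof -
    have "sym R" by (auto simp: R_def sym_def dist_commute)
    then show ?thesis using that by (meson sym_rtrancl symD)
  qed
  have "(a, b) \<in> R\<^sup>*"
  proof (rule connected_equivalence_relation[OF K ab, where R = "\<lambda>x y. (x, y) \<in> R\<^sup>*"])
    show "(y, x) \<in> R\<^sup>*" if "(x, y) \<in> R\<^sup>*" for x y using that by (rule sym)
    show "(x, z) \<in> R\<^sup>*" if "(x, y) \<in> R\<^sup>*" "(y, z) \<in> R\<^sup>*" for x y z using that by (rule rtrancl_trans)
    show "\<exists>T. openin (top_of_set K) T \<and> x \<in> T \<and> (\<forall>y\<in>T. (x, y) \<in> R\<^sup>*)" if "x \<in> K" for x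
      by (rule exI[of _ "K \<inter> ball x \<epsilon>"]) (use that \<epsilon> in \<open>auto simp: R_def openin_open_Int\<close>)
  qed
  then have ex: "\<exists>n. (a, b) \<in> R ^^ n" by (simp add: rtrancl_power)
  define n where "n = (LEAST n. (a, b) \<in> R ^^ n)"
  have n: "(a, b) \<in> R ^^ n" unfolding n_def using LeastI_ex[OF ex] .
  have least: "n \<le> k" if "(a, b) \<in> R ^^ k" for k unfolding n_def using that by (rule Least_le)
  from n obtain f where f: "f 0 = a" "f n = b" "\<And>i. i < n \<Longrightarrow> (f i, f (Suc i)) \<in> R"
    by (auto simp: relpow_fun_conv)
  have sub: "(f i, f (i + k)) \<in> R ^^ k" if "i + k \<le> n" for i k
    using that by (induction k) (auto intro!: relpow_Suc_I f)
  show ?thesis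
  proof
    show "f 0 = a" "f n = b" by fact+
    show "dist (f i) (f (Suc i)) < \<epsilon>" if "i < n" for i using f(3)[OF that] by (simp add: R_def)
    show fK: "f i \<in> K" if "i \<le> n" for i
      using that f(2) f(3)[of i] ab by (cases "i = n") (auto simp: R_def)
    show "\<epsilon> \<le> dist (f i) (f j)" if ij: "i + 2 \<le> j" "j \<le> n" for i j
    proof (rule ccontr)
      assume "\<not> ?thesis"
      then have "(f i, f j) \<in> R" using fK ij by (auto simp: R_def)
      moreover have "(a, f i) \<in> R ^^ i" using sub[of 0 i] ij f(1) by simp
      ultimately have "(a, f j) \<in> R ^^ Suc i" by (rule relpow_Suc_I[rotated])
      moreover have "(f j, b) \<in> R ^^ (n - j)" using sub[of j "n - j"] ij f(2) by simp
      ultimately have "(a, b) \<in> R ^^ (Suc i + (n - j))" unfolding relpow_add by (rule relcompI)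
      then show False using least[of "Suc i + (n - j)"] ij by simp
    qed
  qed
qed

text \<open>The balls of radius \<open>\<epsilon> / 3\<close> around every second point of a minimal \<open>\<epsilon>\<close>-chain are separated,
  and each of them contains measure at least \<open>\<epsilon> / 3\<close> of the connected set.  This bounds the number of
  links, hence the length of the chain, independently of \<open>\<epsilon>\<close>.\<close>

lemma connected_chain_bounded_length:
  fixes K :: "'a::metric_space set"
  assumes K: "connected K" and ab: "a \<in> K" "b \<in> K" and \<epsilon>: "0 < \<epsilon>" "\<epsilon> \<le> dist a b"
    and fin: "hausdorff1 K < \<infinity>"
  obtains n f where "f 0 = a" "f n = b" "\<And>i. i \<le> n \<Longrightarrow> f i \<in> K"
    "\<And>i. i < n \<Longrightarrow> dist (f i) (f (Suc i)) < \<epsilon>" "real n * \<epsilon> \<le> 6 * enn2real (hausdorff1 K)"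
proof -
  obtain n f where f: "f 0 = a" "f n = b" "\<And>i. i \<le> n \<Longrightarrow> f i \<in> K"
      "\<And>i. i < n \<Longrightarrow> dist (f i) (f (Suc i)) < \<epsilon>"
      "\<And>i j. i + 2 \<le> j \<Longrightarrow> j \<le> n \<Longrightarrow> \<epsilon> \<le> dist (f i) (f j)"
    by (rule connected_minimal_chain[OF K ab \<epsilon>(1)]) (rule that)
  let ?B = "\<lambda>i. K \<inter> ball (f (2 * i)) (\<epsilon> / 3)"
  have low: "ennreal (\<epsilon> / 3) \<le> hausdorff1 (?B i)" if "2 * i \<le> n" for i
  proof -
    have "\<epsilon> / 3 \<le> dist (f (2 * i)) a \<or> \<epsilon> / 3 \<le> dist (f (2 * i)) b"
      using dist_triangle2[of a b "f (2 * i)"] \<epsilon> by (simp add: dist_commute) linarith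
    then show ?thesis
      using hausdorff1_Int_ball_ge[OF K f(3)[OF that]] ab \<epsilon> by auto
  qed
  have "ennreal (real m * (\<epsilon> / 3)) \<le> hausdorff1 (\<Union>i<m. ?B i)" if "2 * (m - 1) \<le> n" for m
    using that
  proof (induction m)
    case (Suc m)
    have "real (Suc m) * (\<epsilon> / 3) = real m * (\<epsilon> / 3) + \<epsilon> / 3"
      by (simp add: algebra_simps add_divide_distrib)
    then have "ennreal (real (Suc m) * (\<epsilon> / 3)) = ennreal (real m * (\<epsilon> / 3)) + ennreal (\<epsilon> / 3)"
      using \<epsilon> by (metis ennreal_plus less_imp_le mult_nonneg_nonneg of_nat_0_le_iff zero_le_divide_iff zero_le_numeral)
    also have "\<dots> \<le> hausdorff1 (\<Union>i<m. ?B i) + hausdorff1 (?B m)"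
      using Suc by (intro add_mono low) auto
    also have "\<dots> \<le> hausdorff1 ((\<Union>i<m. ?B i) \<union> ?B m)"
    proof (rule hausdorff1_Un_separated[where \<eta> = "\<epsilon> / 3"])
      fix x y assume "x \<in> (\<Union>i<m. ?B i)" and y: "y \<in> ?B m"
      then obtain i where i: "i < m" "x \<in> ?B i" by blast
      have "\<epsilon> \<le> dist (f (2 * i)) (f (2 * m))" using i Suc.prems by (intro f(5)) auto
      moreover have "dist (f (2 * i)) (f (2 * m)) \<le> dist (f (2 * i)) x + dist x y + dist (f (2 * m)) y"
        using dist_triangle[of "f (2 * i)" "f (2 * m)" x] dist_triangle[of x "f (2 * m)" y]
        by (simp add: dist_commute)
      ultimately show "\<epsilon> / 3 \<le> dist x y" using i(2) y by (auto simp del: divide_const_simps)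
    qed (use \<epsilon> in simp)
    also have "(\<Union>i<m. ?B i) \<union> ?B m = (\<Union>i<Suc m. ?B i)" by (auto simp: lessThan_Suc)
    finally show ?case .
  qed simp
  from this[of "Suc (n div 2)"]
  have "ennreal (real (Suc (n div 2)) * (\<epsilon> / 3)) \<le> hausdorff1 (\<Union>i<Suc (n div 2). ?B i)" by simp
  also have "\<dots> \<le> hausdorff1 K" by (intro hausdorff1_mono) auto
  finally have "real (Suc (n div 2)) * (\<epsilon> / 3) \<le> enn2real (hausdorff1 K)"
    using fin by (cases "hausdorff1 K" rule: ennreal_cases) auto
  moreover have "real n / 2 * (\<epsilon> / 3) \<le> real (Suc (n div 2)) * (\<epsilon> / 3)"
    using \<epsilon> by (intro mult_right_mono) linarith+
  ultimately have "real n * \<epsilon> \<le> 6 * enn2real (hausdorff1 K)" by (simp add: mult.commute)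
  with f that show ?thesis by blast
qed

text \<open>A continuum of finite length contains a Lipschitz curve between any two of its points.  Chains of
  bounded length and mesh \<open>\<epsilon>\<close> are maps from the unit interval that are Lipschitz up to an error
  \<open>\<epsilon>\<close>, with one constant for all \<open>\<epsilon>\<close>.  The sets of these maps are closed and nested in a compact product
  space, so they have a common element.\<close>

lemma continuum_finite_hausdorff1_path_connected:
  fixes K :: "'a::metric_space set"
  assumes K: "connected K" "compact K" and fin: "hausdorff1 K < \<infinity>"
  shows "path_connected K"
  unfolding path_connected_def
proof (intro ballI)
  fix a b assume ab: "a \<in> K" "b \<in> K"
  show "\<exists>g. path g \<and> path_image g \<subseteq> K \<and> pathstart g = a \<and> pathfinish g = b"
  proof (cases "a = b")
    case True
    then show ?thesis using ab by (intro exI[of _ "\<lambda>_. a"]) (auto simp: path_def path_image_def pathstart_def pathfinish_def)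
  next
    case False
    define L where "L = 6 * enn2real (hausdorff1 K)"
    define M :: "real \<Rightarrow> (real \<Rightarrow> 'a) set" where
      "M \<epsilon> = {g. g 0 = a \<and> g 1 = b \<and> (\<forall>t\<in>{0..1}. \<forall>t'\<in>{0..1}. dist (g t) (g t') \<le> L * \<bar>t - t'\<bar> + \<epsilon>)}" for \<epsilon>
    have L0: "0 \<le> L" by (simp add: L_def)
    have "compactin (product_topology (\<lambda>_::real. euclidean) UNIV) (PiE UNIV (\<lambda>_. K))"
      unfolding compactin_PiE using K(2) by simp
    then have comp: "compact (PiE UNIV (\<lambda>_::real. K))"
      by (simp add: euclidean_product_topology)
    have clos: "closed (M \<epsilon>)" for \<epsilon>
    proof -
      have "M \<epsilon> = {g. g 0 = a} \<inter> {g. g 1 = b} \<inter>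
          (\<Inter>t\<in>{0..1}. \<Inter>t'\<in>{0..1}. {g. dist (g t) (g t') \<le> L * \<bar>t - t'\<bar> + \<epsilon>})"
        by (auto simp: M_def)
      also have "closed \<dots>"
        by (intro closed_Int closed_INT ballI closed_Collect_eq closed_Collect_le continuous_intros) auto
      finally show ?thesis .
    qed
    have ne: "PiE UNIV (\<lambda>_. K) \<inter> M \<epsilon> \<noteq> {}" if \<epsilon>: "0 < \<epsilon>" "\<epsilon> \<le> dist a b" for \<epsilon>
    proof -
      obtain n f where f: "f 0 = a" "f n = b" "\<And>i. i \<le> n \<Longrightarrow> f i \<in> K"
          "\<And>i. i < n \<Longrightarrow> dist (f i) (f (Suc i)) < \<epsilon>" "real n * \<epsilon> \<le> L"
        by (rule connected_chain_bounded_length[OF K(1) ab \<epsilon> fin, folded L_def]) (rule that)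
      have chain: "dist (f i) (f (i + k)) \<le> real k * \<epsilon>" if "i + k \<le> n" for i k
        using that
      proof (induction k)
        case (Suc k)
        have "dist (f i) (f (i + Suc k)) \<le> dist (f i) (f (i + k)) + dist (f (i + k)) (f (Suc (i + k)))"
          using dist_triangle[of "f i" "f (Suc (i + k))" "f (i + k)"] by simp
        also have "\<dots> \<le> real k * \<epsilon> + \<epsilon>"
          using Suc f(4)[of "i + k"] by (intro add_mono) auto
        finally show ?case by (simp add: algebra_simps)
      qed simp
      define N where "N t = min n (nat \<lfloor>real n * t\<rfloor>)" for t
      define g where "g t = f (N t)" for t
      have le: "dist (g t) (g t') \<le> L * \<bar>t - t'\<bar> + \<epsilon>" if "0 \<le> t" "t \<le> t'" for t t'
      proof -
        have nt: "real n * t \<le> real n * t'" using that by (intro mult_left_mono) auto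
        then have "N t \<le> N t'" unfolding N_def
          by (intro min.mono nat_mono floor_mono) auto
        then obtain k where k: "N t' = N t + k" by (metis le_add_diff_inverse)
        have "real k \<le> real n * (t' - t) + 1"
        proof -
          have "nat \<lfloor>real n * t\<rfloor> \<le> nat \<lfloor>real n * t'\<rfloor>" using nt by (intro nat_mono floor_mono)
          then have "k \<le> nat \<lfloor>real n * t'\<rfloor> - nat \<lfloor>real n * t\<rfloor>" using k by (simp add: N_def)
          then have "real k \<le> real (nat \<lfloor>real n * t'\<rfloor>) - real (nat \<lfloor>real n * t\<rfloor>)"
            using \<open>nat _ \<le> nat _\<close> by linarith
          moreover have "real (nat \<lfloor>real n * t'\<rfloor>) \<le> real n * t'" using that by (intro of_nat_floor) auto
          moreover have "real n * t - 1 \<le> real (nat \<lfloor>real n * t\<rfloor>)" by linarith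
          moreover have "real n * (t' - t) = real n * t' - real n * t" by (rule right_diff_distrib)
          ultimately show ?thesis by linarith
        qed
        moreover have "dist (g t) (g t') \<le> real k * \<epsilon>"
          unfolding g_def k by (rule chain) (use k in \<open>auto simp: N_def\<close>)
        ultimately have "dist (g t) (g t') \<le> (real n * (t' - t) + 1) * \<epsilon>"
          using \<epsilon>(1) by (meson less_imp_le mult_right_mono order_trans)
        also have "\<dots> = (real n * \<epsilon>) * (t' - t) + \<epsilon>" by (simp add: algebra_simps)
        also have "\<dots> \<le> L * (t' - t) + \<epsilon>" using f(5) that by (intro add_right_mono mult_right_mono) auto
        finally show ?thesis using that by simp
      qed
      have "dist (g t) (g t') \<le> L * \<bar>t - t'\<bar> + \<epsilon>" if "t \<in> {0..1}" "t' \<in> {0..1}" for t t'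
        using le[of t t'] le[of t' t] that by (cases "t \<le> t'") (auto simp: dist_commute abs_minus_commute)
      then have "g \<in> M \<epsilon>" using f(1,2) by (simp add: M_def g_def N_def)
      moreover have "g \<in> PiE UNIV (\<lambda>_. K)" using f(3) by (auto simp: g_def N_def)
      ultimately show ?thesis by blast
    qed
    have "PiE UNIV (\<lambda>_. K) \<inter> (\<Inter>\<epsilon>\<in>{0<..}. M \<epsilon>) \<noteq> {}"
    proof (rule compact_imp_fip_image[OF comp])
      fix I assume I: "finite I" "I \<subseteq> {0::real<..}"
      define \<epsilon> where "\<epsilon> = Min (insert (dist a b) I)"
      have "0 < \<epsilon>" unfolding \<epsilon>_def using I False by (subst Min_gr_iff) auto
      moreover have "\<epsilon> \<le> dist a b" unfolding \<epsilon>_def using I by (intro Min_le) auto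
      ultimately have "PiE UNIV (\<lambda>_. K) \<inter> M \<epsilon> \<noteq> {}" by (rule ne)
      moreover have "M \<epsilon> \<subseteq> M \<epsilon>'" if "\<epsilon>' \<in> I" for \<epsilon>'
      proof -
        have "\<epsilon> \<le> \<epsilon>'" unfolding \<epsilon>_def using I that by (intro Min_le) auto
        then show ?thesis unfolding M_def by force
      qed
      ultimately show "PiE UNIV (\<lambda>_. K) \<inter> (\<Inter>\<epsilon>\<in>I. M \<epsilon>) \<noteq> {}" by blast
    qed (rule clos)
    then obtain g where g: "\<And>t. g t \<in> K" "\<And>\<epsilon>. 0 < \<epsilon> \<Longrightarrow> g \<in> M \<epsilon>" by auto
    have "dist (g t) (g t') \<le> L * dist t t'" if "t \<in> {0..1}" "t' \<in> {0..1}" for t t'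
      by (rule field_le_epsilon) (use g(2) that in \<open>auto simp: M_def dist_real_def\<close>)
    then have "L-lipschitz_on {0..1} g" using L0 by (intro lipschitz_onI)
    then have "path g" unfolding path_def by (rule lipschitz_on_continuous_on)
    moreover have "g 0 = a" "g 1 = b" using g(2)[of 1] by (auto simp: M_def)
    ultimately show ?thesis using g(1)
      by (intro exI[of _ g]) (auto simp: path_image_def pathstart_def pathfinish_def)
  qed
qed

section \<open>Arc networks and shortest continua\<close>

definition arc_between :: "'a::topological_space \<Rightarrow> 'a \<Rightarrow> 'a set \<Rightarrow> bool" where
  "arc_between a b C \<longleftrightarrow> (\<exists>g. arc g \<and> pathstart g = a \<and> pathfinish g = b \<and> path_image g = C)"

lemma arc_between_facts:
  fixes a b :: "'a::t2_space"
  assumes "arc_between a b C"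
  shows "a \<in> C" "b \<in> C" "compact C" "connected C" "a \<noteq> b"
proof -
  obtain g where g: "arc g" "pathstart g = a" "pathfinish g = b" "path_image g = C"
    using assms unfolding arc_between_def by blast
  show "a \<in> C" "b \<in> C" using g by auto
  show "compact C" "connected C" using g(1,4) by (auto simp: compact_arc_image connected_arc_image)
  show "a \<noteq> b" using g arc_distinct_ends by blast
qed

lemma hausdorff1_arc_between_ge:
  fixes a b :: "'a::metric_space"
  assumes "arc_between a b C"
  shows "ennreal (dist a b) \<le> hausdorff1 C"
  using arc_between_facts[OF assms] by (intro hausdorff1_connected_ge_dist) auto

lemma arc_between_subpath:
  fixes g :: "real \<Rightarrow> 'a::real_normed_vector"
  assumes "arc g" "0 \<le> u" "u < v" "v \<le> 1"
  shows "arc_between (g u) (g v) (g ` {u..v})"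
  unfolding arc_between_def using assms
  by (intro exI[of _ "subpath u v g"]) (auto simp: arc_subpath_arc path_image_subpath)

lemma arc_between_cut:
  fixes a b w :: "'a::real_normed_vector"
  assumes C: "arc_between a b C" and w: "w \<in> C" "w \<noteq> a" "w \<noteq> b"
  obtains C1 C2 where "arc_between a w C1" "arc_between w b C2" "C1 \<union> C2 = C" "C1 \<inter> C2 = {w}"
proof -
  obtain g where g: "arc g" "g 0 = a" "g 1 = b" "g ` {0..1} = C"
    using C unfolding arc_between_def pathstart_def pathfinish_def path_image_def by blast
  obtain u where u: "0 \<le> u" "u \<le> 1" "g u = w" using w(1) g(4) by auto
  then have u': "0 < u" "u < 1" using w g by (auto simp: less_le)
  show ?thesis
  proof
    show "arc_between a w (g ` {0..u})" using arc_between_subpath[of g 0 u] g u u' by simp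
    show "arc_between w b (g ` {u..1})" using arc_between_subpath[of g u 1] g u u' by simp
    have "g ` {0..u} \<union> g ` {u..1} = g ` ({0..u} \<union> {u..1})" by (rule image_Un[symmetric])
    also have "{0..u} \<union> {u..1} = {0..1}" using u by (intro ivl_disj_un_two_touch) auto
    finally show "g ` {0..u} \<union> g ` {u..1} = C" using g(4) by simp
    have "g ` {0..u} \<inter> g ` {u..1} = g ` ({0..u} \<inter> {u..1})"
      by (rule inj_on_image_Int[symmetric, OF arc_imp_inj_on[OF g(1)]]) (use u in auto)
    also have "{0..u} \<inter> {u..1} = {u}" using u by auto
    finally show "g ` {0..u} \<inter> g ` {u..1} = {w}" using u(3) by simp
  qed
qed

lemma hausdorff1_arc_between_cut:
  fixes a b :: "'a::metric_space"
  assumes "arc_between a w C1" "C1 \<union> C2 = C" "C1 \<inter> C2 = {w}"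
  shows "hausdorff1 C1 + hausdorff1 C2 \<le> hausdorff1 C"
  by (rule hausdorff1_add_le[of _ _ _ w])
     (use assms arc_between_facts(3)[OF assms(1)] in \<open>auto intro: compact_imp_closed\<close>)

text \<open>Cutting the arc at one of its points \<open>p\<close> shows that its length is at least the length of the
  polygonal line through \<open>a\<close>, \<open>p\<close> and \<open>b\<close>; equality in the triangle inequality puts \<open>p\<close> on the
  segment.\<close>

lemma arc_between_straight:
  fixes a b :: "'a::euclidean_space"
  assumes C: "arc_between a b C" and short: "hausdorff1 C \<le> ennreal (dist a b)"
  shows "C = closed_segment a b"
proof
  note C' = arc_between_facts[OF C]
  show sub: "C \<subseteq> closed_segment a b"
  proof
    fix p assume p: "p \<in> C"
    show "p \<in> closed_segment a b"
    proof (cases "p = a \<or> p = b")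
      case False
      then obtain C1 C2 where C12: "arc_between a p C1" "arc_between p b C2" "C1 \<union> C2 = C" "C1 \<inter> C2 = {p}"
        using arc_between_cut[OF C p] by metis
      have "ennreal (dist a p + dist p b) \<le> hausdorff1 C1 + hausdorff1 C2"
        by (simp add: add_mono hausdorff1_arc_between_ge C12)
      also have "\<dots> \<le> hausdorff1 C" by (rule hausdorff1_arc_between_cut) fact+
      finally have "ennreal (dist a p + dist p b) \<le> ennreal (dist a b)" using short by order
      then have "dist a p + dist p b \<le> dist a b" by (subst (asm) ennreal_le_iff) auto
      then have "between (a, b) p" unfolding between using dist_triangle[of a b p] by simp
      then show ?thesis by (simp add: between_mem_segment)
    qed auto
  qed
  show "closed_segment a b \<subseteq> C"
  proof
    fix p assume "p \<in> closed_segment a b"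
    then obtain t where t: "0 \<le> t" "t \<le> 1" "p = a + t *\<^sub>R (b - a)"
      by (auto simp: closed_segment_def algebra_simps)
    have d: "dist a (a + u *\<^sub>R (b - a)) = u * dist a b" if "0 \<le> u" for u
      using that by (simp add: dist_norm norm_minus_commute)
    have "t * dist a b \<le> dist a b" using t by (simp add: mult_left_le_one_le)
    then obtain z where z: "z \<in> C" "dist a z = t * dist a b"
      using connected_meets_sphere[of C a b a "t * dist a b"] C' t by auto
    then obtain u where u: "0 \<le> u" "z = a + u *\<^sub>R (b - a)"
      using sub by (auto simp: closed_segment_def algebra_simps)
    then have "u = t" using z(2) d[of u] C'(5) by simp
    then show "p \<in> C" using z(1) u t by simp
  qed
qed

lemma path_connected_arc_to_first_hit:
  fixes K :: "'a::euclidean_space set"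
  assumes K: "path_connected K" "t \<in> K" and U: "closed U" "t \<notin> U" "s \<in> U" "s \<in> K"
  obtains w D where "w \<in> U" "arc_between t w D" "D \<subseteq> K" "D \<inter> U = {w}"
proof -
  have "t \<noteq> s" using U by blast
  then obtain g where g: "arc g" "path_image g \<subseteq> K" "pathstart g = t" "pathfinish g = s"
    using K U(4) unfolding path_connected_arcwise by blast
  define Z where "Z = {0..1} \<inter> g -` U"
  have cont: "continuous_on {0..1} g" using g(1) by (simp add: arc_def path_def)
  have "closed Z" unfolding Z_def using cont U(1) by (intro continuous_closed_preimage) auto
  then have "compact Z" using compact_Int_closed[of "{0..1::real}" Z] by (simp add: Z_def Int_assoc[symmetric])
  moreover have "Z \<noteq> {}" proof -
    have "1 \<in> Z" using g(4) U(3) by (simp add: Z_def pathfinish_def)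
    then show ?thesis by blast
  qed
  ultimately obtain u where u: "u \<in> Z" "\<And>v. v \<in> Z \<Longrightarrow> u \<le> v" using compact_attains_inf by metis
  have u': "0 < u" "u \<le> 1" "g u \<in> U"
    using u(1) g(3) U(2) by (auto simp: Z_def pathstart_def less_le)
  show ?thesis
  proof
    show "g u \<in> U" by fact
    show "arc_between t (g u) (g ` {0..u})"
      using arc_between_subpath[of g 0 u] g u' by (simp add: pathstart_def)
    show "g ` {0..u} \<subseteq> K" using g(2) u' by (auto simp: path_image_def)
    have "g v \<notin> U" if "0 \<le> v" "v < u" for v using u(2)[of v] that u' by (auto simp: Z_def)
    then show "g ` {0..u} \<inter> U = {g u}" using u' by (force simp: less_le)
  qed
qed

text \<open>The edges of a network are triples of two end points and the arc, as a point set, between them.\<close>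

definition links :: "('a \<times> 'a \<times> 'a set) set \<Rightarrow> ('a \<times> 'a) set" where
  "links E = {(a, b). \<exists>C. (a, b, C) \<in> E \<or> (b, a, C) \<in> E}"

definition arcs_support :: "('a \<times> 'a \<times> 'a set) set \<Rightarrow> 'a set" where
  "arcs_support E = (\<Union>(a, b, C)\<in>E. C)"

text \<open>The inequality between the lengths expresses that the arcs overlap only in a null set, in a form
  that is easily kept when arcs are cut or attached.  Connectedness is stated for the graph
  because it has to survive the replacement of the arcs by their chords.\<close>

definition arc_network :: "'a::metric_space set \<Rightarrow> ('a \<times> 'a \<times> 'a set) set \<Rightarrow> bool" where
  "arc_network V E \<longleftrightarrow> finite V \<and> finite E \<and>
     (\<forall>a b C. (a, b, C) \<in> E \<longrightarrow> a \<in> V \<and> b \<in> V \<and> arc_between a b C) \<and>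
     V \<times> V \<subseteq> (links E)\<^sup>* \<and>
     (\<Sum>(a, b, C)\<in>E. hausdorff1 C) \<le> hausdorff1 (arcs_support E)"

lemma links_sym: "(u, v) \<in> (links E)\<^sup>* \<Longrightarrow> (v, u) \<in> (links E)\<^sup>*"
proof -
  have "sym (links E)" by (auto simp: links_def sym_def)
  then show "(u, v) \<in> (links E)\<^sup>* \<Longrightarrow> (v, u) \<in> (links E)\<^sup>*" by (meson sym_rtrancl symD)
qed

lemma links_insert_connected:
  assumes V: "V \<times> V \<subseteq> (links E)\<^sup>*" and "v \<in> V" "(w, v) \<in> (links E)\<^sup>*"
  shows "insert w V \<times> insert w V \<subseteq> (links E)\<^sup>*"
proof -
  have "(w, u) \<in> (links E)\<^sup>*" if "u \<in> V" for u
    using assms that by (meson SigmaI rtrancl_trans subsetD)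
  then show ?thesis using V by (auto intro: links_sym)
qed

lemma sum_insert_le:
  fixes f :: "'a \<Rightarrow> ennreal"
  assumes "finite A" shows "sum f (insert x A) \<le> f x + sum f A"
  using assms by (cases "x \<in> A") (auto simp: insert_absorb)

lemma arc_network_subdivide:
  fixes V :: "'a::real_normed_vector set"
  assumes net: "arc_network V E" and w: "w \<in> arcs_support E" "w \<notin> V"
  obtains E' where "arc_network (insert w V) E'" "arcs_support E' = arcs_support E"
    "card E' \<le> Suc (card E)"
proof -
  have fin: "finite V" "finite E" and ends: "\<And>a b C. (a, b, C) \<in> E \<Longrightarrow> a \<in> V \<and> b \<in> V \<and> arc_between a b C"
    and conn: "V \<times> V \<subseteq> (links E)\<^sup>*"
    and len: "(\<Sum>(a, b, C)\<in>E. hausdorff1 C) \<le> hausdorff1 (arcs_support E)"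
    using net unfolding arc_network_def by blast+
  obtain a b C where e: "(a, b, C) \<in> E" "w \<in> C" using w(1) by (auto simp: arcs_support_def)
  then have ab: "a \<in> V" "b \<in> V" "arc_between a b C" using ends by auto
  then obtain C1 C2 where C12: "arc_between a w C1" "arc_between w b C2" "C1 \<union> C2 = C" "C1 \<inter> C2 = {w}"
    using arc_between_cut[OF ab(3) e(2)] w(2) by metis
  define E0 where "E0 = E - {(a, b, C)}"
  define E' where "E' = insert (a, w, C1) (insert (w, b, C2) E0)"
  have E: "E = insert (a, b, C) E0" and E0: "finite E0" "(a, b, C) \<notin> E0"
    using e(1) fin by (auto simp: E0_def)
  have supp: "arcs_support E' = arcs_support E"
    using C12(3) by (auto simp: E E'_def arcs_support_def)
  have aw: "(a, w) \<in> links E'" "(w, b) \<in> links E'" by (auto simp: links_def E'_def)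
  then have "(a, b) \<in> (links E')\<^sup>*" by (meson r_into_rtrancl rtrancl_into_rtrancl)
  moreover from this have "(b, a) \<in> (links E')\<^sup>*" by (rule links_sym)
  moreover have "links E0 \<subseteq> links E'" by (auto simp: links_def E'_def)
  then have "links E0 \<subseteq> (links E')\<^sup>*" by blast
  moreover have "links E = insert (a, b) (insert (b, a) (links E0))" by (auto simp: links_def E)
  ultimately have "links E \<subseteq> (links E')\<^sup>*" by simp
  then have "V \<times> V \<subseteq> (links E')\<^sup>*"
    using conn rtrancl_subset_rtrancl by blast
  moreover have "(w, b) \<in> (links E')\<^sup>*" using aw by blast
  ultimately have conn': "insert w V \<times> insert w V \<subseteq> (links E')\<^sup>*"
    using ab(2) by (intro links_insert_connected)
  have "(\<Sum>(a, b, C)\<in>E'. hausdorff1 C) \<le> hausdorff1 C1 + (\<Sum>(a, b, C)\<in>insert (w, b, C2) E0. hausdorff1 C)"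
    unfolding E'_def by (rule order_trans[OF sum_insert_le]) (use E0 in auto)
  also have "\<dots> \<le> hausdorff1 C1 + (hausdorff1 C2 + (\<Sum>(a, b, C)\<in>E0. hausdorff1 C))"
    by (intro add_left_mono, rule order_trans[OF sum_insert_le]) (use E0 in auto)
  also have "\<dots> = (hausdorff1 C1 + hausdorff1 C2) + (\<Sum>(a, b, C)\<in>E0. hausdorff1 C)"
    by (simp add: add.assoc)
  also have "\<dots> \<le> hausdorff1 C + (\<Sum>(a, b, C)\<in>E0. hausdorff1 C)"
    by (intro add_right_mono hausdorff1_arc_between_cut[OF C12(1,3,4)])
  also have "\<dots> = (\<Sum>(a, b, C)\<in>E. hausdorff1 C)" using E0 by (simp add: E)
  finally have len': "(\<Sum>(a, b, C)\<in>E'. hausdorff1 C) \<le> hausdorff1 (arcs_support E')"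
    using len supp by simp
  have "card E' \<le> Suc (Suc (card E0))"
    unfolding E'_def using E0 by (simp add: card_insert_if)
  then have card': "card E' \<le> Suc (card E)" using E0 by (simp add: E)
  have ends': "x \<in> insert w V \<and> y \<in> insert w V \<and> arc_between x y D" if "(x, y, D) \<in> E'" for x y D
    using that ends ab C12 by (auto simp: E'_def E)
  show ?thesis
  proof
    show "arc_network (insert w V) E'"
      unfolding arc_network_def using fin E0 ends' conn' len' by (auto simp: E'_def)
  qed fact+
qed

lemma arc_network_attach:
  fixes V :: "'a::real_normed_vector set"
  assumes net: "arc_network V E" and w: "w \<in> V"
    and D: "arc_between t w D" "D \<inter> arcs_support E \<subseteq> {w}"
  shows "arc_network (insert t V) (insert (t, w, D) E)"
proof -
  let ?E = "insert (t, w, D) E"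
  have fin: "finite V" "finite E" and ends: "\<And>a b C. (a, b, C) \<in> E \<Longrightarrow> a \<in> V \<and> b \<in> V \<and> arc_between a b C"
    and conn: "V \<times> V \<subseteq> (links E)\<^sup>*"
    and len: "(\<Sum>(a, b, C)\<in>E. hausdorff1 C) \<le> hausdorff1 (arcs_support E)"
    using net unfolding arc_network_def by blast+
  have "links E \<subseteq> links ?E" by (auto simp: links_def)
  then have "V \<times> V \<subseteq> (links ?E)\<^sup>*" using conn rtrancl_mono by blast
  moreover have "(t, w) \<in> (links ?E)\<^sup>*" by (intro r_into_rtrancl) (auto simp: links_def)
  ultimately have conn': "insert t V \<times> insert t V \<subseteq> (links ?E)\<^sup>*"
    using w by (intro links_insert_connected)
  have "(\<Sum>(a, b, C)\<in>?E. hausdorff1 C) \<le> hausdorff1 D + (\<Sum>(a, b, C)\<in>E. hausdorff1 C)"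
    by (rule order_trans[OF sum_insert_le]) (use fin in auto)
  also have "\<dots> \<le> hausdorff1 D + hausdorff1 (arcs_support E)" using len by (rule add_left_mono)
  also have "\<dots> \<le> hausdorff1 (arcs_support ?E)"
    using D arc_between_facts(3)[OF D(1)]
    by (intro hausdorff1_add_le[of _ _ _ w]) (auto simp: arcs_support_def compact_imp_closed)
  finally have len': "(\<Sum>(a, b, C)\<in>?E. hausdorff1 C) \<le> hausdorff1 (arcs_support ?E)" .
  show ?thesis
    unfolding arc_network_def using fin ends conn' len' w D(1) by auto
qed

lemma closed_arcs_support:
  assumes "arc_network V E"
  shows "closed (arcs_support E)"
proof -
  have "closed C" if "(a, b, C) \<in> E" for a b C
    using assms that arc_between_facts(3)[of a b C] unfolding arc_network_def
    by (blast intro: compact_imp_closed)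
  then show ?thesis using assms
    by (auto simp: arcs_support_def arc_network_def intro!: closed_UN)
qed

text \<open>The terminals are joined to the network one at a time, along an arc that is stopped where it first
  hits the network.  A new terminal adds two vertices at most, itself and the point that is hit; and
  two edges at most, the new arc and one more because the arc that is hit is cut in two.\<close>

lemma arc_network_exists:
  fixes K :: "'a::euclidean_space set"
  assumes K: "path_connected K" and T: "finite T" "T \<noteq> {}" "T \<subseteq> K"
  obtains V E where "arc_network V E" "T \<subseteq> V" "V \<subseteq> T \<union> arcs_support E" "arcs_support E \<subseteq> K"
    "card V \<le> 2 * card T" "card E \<le> 2 * card T"
proof -
  have "\<exists>V E. arc_network V E \<and> T \<subseteq> V \<and> V \<subseteq> T \<union> arcs_support E \<and> arcs_support E \<subseteq> K \<and>
      card V \<le> 2 * card T \<and> card E \<le> 2 * card T"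
    using T
  proof (induction rule: finite_ne_induct)
    case (singleton t)
    have "arc_network {t} {}" by (simp add: arc_network_def)
    then show ?case by (intro exI[of _ "{t}"] exI[of _ "{}"]) (auto simp: arcs_support_def)
  next
    case (insert t T)
    then obtain V E where VE: "arc_network V E" "T \<subseteq> V" "V \<subseteq> T \<union> arcs_support E" "arcs_support E \<subseteq> K"
        "card V \<le> 2 * card T" "card E \<le> 2 * card T"
      by auto
    have fin: "finite V" "finite E" using VE(1) by (auto simp: arc_network_def)
    have cT: "card (insert t T) = Suc (card T)" using insert by simp
    show ?case
    proof (cases "t \<in> V \<union> arcs_support E")
      case False
      have clos: "closed (V \<union> arcs_support E)"
        using closed_arcs_support[OF VE(1)] fin(1) by (intro closed_Un) (auto intro: finite_imp_closed)
      obtain s where s: "s \<in> T" using insert by blast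
      obtain w D where wD: "w \<in> V \<union> arcs_support E" "arc_between t w D" "D \<subseteq> K"
          "D \<inter> (V \<union> arcs_support E) = {w}"
        using path_connected_arc_to_first_hit[OF K, of t "V \<union> arcs_support E" s] clos False s insert.prems VE(2)
        by (metis Un_iff insert_subset subsetD)
      have "\<exists>V1 E1. arc_network V1 E1 \<and> V1 = insert w V \<and> arcs_support E1 = arcs_support E \<and>
          card E1 \<le> Suc (card E)"
      proof (cases "w \<in> V")
        case True
        then show ?thesis using VE(1) by (intro exI[of _ V] exI[of _ E]) (auto simp: insert_absorb)
      next
        case False
        then show ?thesis using arc_network_subdivide[OF VE(1), of w] wD(1) by blast
      qed
      then obtain E1 where E1: "arc_network (insert w V) E1" "arcs_support E1 = arcs_support E"
          "card E1 \<le> Suc (card E)" by blast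
      define V2 E2 where "V2 = insert t (insert w V)" and "E2 = insert (t, w, D) E1"
      have "arc_network V2 E2"
        unfolding V2_def E2_def using E1 wD by (intro arc_network_attach) auto
      moreover have supp: "arcs_support E2 = D \<union> arcs_support E"
        using E1(2) by (auto simp: E2_def arcs_support_def)
      moreover have "card V2 \<le> Suc (Suc (card V))"
        unfolding V2_def using card_insert_le_m1 fin(1) by (simp add: card_insert_if)
      moreover have "finite E1" using E1(1) by (simp add: arc_network_def)
      then have "card E2 \<le> Suc (card E1)" unfolding E2_def by (simp add: card_insert_if)
      moreover have "w \<in> D" using wD by blast
      ultimately show ?thesis
        using VE E1 wD(3) cT insert.prems
        by (intro exI[of _ V2] exI[of _ E2]) (auto simp: V2_def)
    next
      case True
      have "\<exists>V1 E1. arc_network V1 E1 \<and> V1 = insert t V \<and> arcs_support E1 = arcs_support E \<and>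
          card E1 \<le> Suc (card E)"
      proof (cases "t \<in> V")
        case True
        then show ?thesis using VE(1) by (intro exI[of _ V] exI[of _ E]) (auto simp: insert_absorb)
      next
        case False
        then show ?thesis using arc_network_subdivide[OF VE(1), of t] True by blast
      qed
      then obtain E1 where E1: "arc_network (insert t V) E1" "arcs_support E1 = arcs_support E"
          "card E1 \<le> Suc (card E)" by blast
      moreover have "card (insert t V) \<le> Suc (card V)" using fin(1) by (simp add: card_insert_if)
      ultimately show ?thesis
        using VE cT insert.prems
        by (intro exI[of _ "insert t V"] exI[of _ E1]) auto
    qed
  qed
  then show ?thesis using that by blast
qed

lemma straightened_network_connected:
  fixes V :: "'a::real_normed_vector set"
  assumes V: "V \<times> V \<subseteq> (links E)\<^sup>*" and ends: "\<And>a b C. (a, b, C) \<in> E \<Longrightarrow> a \<in> V \<and> b \<in> V"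
  shows "connected (V \<union> (\<Union>(a, b, C)\<in>E. closed_segment a b))" (is "connected ?G")
proof -
  have seg: "connected_component ?G x y"
    if "(a, b, C) \<in> E" "x \<in> closed_segment a b" "y \<in> closed_segment a b" for a b C x y
    unfolding connected_component_def using that
    by (intro exI[of _ "closed_segment a b"]) force
  have reach: "connected_component ?G u v" if "(u, v) \<in> (links E)\<^sup>*" "u \<in> V" for u v
    using that(1)
  proof (induction rule: rtrancl_induct)
    case base
    then show ?case using that(2) by simp
  next
    case (step v w)
    then obtain C where "(v, w, C) \<in> E \<or> (w, v, C) \<in> E" by (auto simp: links_def)
    then have "connected_component ?G v w" using seg by (metis ends_in_segment)
    with step.IH show ?case by (rule connected_component_trans)
  qed
  have to_V: "\<exists>v\<in>V. connected_component ?G x v" if x: "x \<in> ?G" for x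
  proof (cases "x \<in> V")
    case True
    then show ?thesis using x by (intro bexI[of _ x]) auto
  next
    case False
    then obtain a b C where "(a, b, C) \<in> E" "x \<in> closed_segment a b" using x by auto
    then show ?thesis using seg[of a b C x a] ends[of a b C] by auto
  qed
  show ?thesis
    unfolding connected_iff_connected_component
  proof (intro ballI)
    fix x y assume "x \<in> ?G" "y \<in> ?G"
    then obtain u v where uv: "u \<in> V" "connected_component ?G x u" "v \<in> V" "connected_component ?G y v"
      using to_V by meson
    then have "connected_component ?G u v" using reach V by blast
    then show "connected_component ?G x y"
      using uv(2) connected_component_sym[OF uv(4)] by (meson connected_component_trans)
  qed
qed

text \<open>Take a network of arcs in \<open>K\<close> that joins the terminals.  The chords of its arcs form a connected
  competitor, whence the chain of inequalities: length of \<open>K\<close> \<open>\<le>\<close> sum of the chords \<open>\<le>\<close> sum of the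
  arcs \<open>\<le>\<close> length of \<open>K\<close>.  All of these are equalities, so each arc is its chord.  The network also
  exhausts \<open>K\<close>, since a point of \<open>K\<close> off the closed network would carry a piece of \<open>K\<close> of positive
  length.\<close>

lemma shortest_continuum_is_union_of_segments:
  fixes K :: "'a::euclidean_space set"
  assumes K: "connected K" "compact K" and fin: "hausdorff1 K < \<infinity>"
    and T: "finite T" "T \<noteq> {}" "T \<subseteq> K"
    and shortest: "\<And>G. connected G \<Longrightarrow> T \<subseteq> G \<Longrightarrow> hausdorff1 K \<le> hausdorff1 G"
  obtains V F where "finite V" "card V \<le> 2 * card T" "finite F" "card F \<le> 2 * card T"
    "F \<subseteq> V \<times> V" "K = T \<union> (\<Union>(a, b)\<in>F. closed_segment a b)"
proof -
  obtain V E where VE: "arc_network V E" "T \<subseteq> V" "V \<subseteq> T \<union> arcs_support E" "arcs_support E \<subseteq> K"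
      "card V \<le> 2 * card T" "card E \<le> 2 * card T"
    using arc_network_exists[OF continuum_finite_hausdorff1_path_connected[OF K fin] T] .
  have finVE: "finite V" "finite E" and ends: "\<And>a b C. (a, b, C) \<in> E \<Longrightarrow> a \<in> V \<and> b \<in> V \<and> arc_between a b C"
    and conn: "V \<times> V \<subseteq> (links E)\<^sup>*"
    and len: "(\<Sum>(a, b, C)\<in>E. hausdorff1 C) \<le> hausdorff1 (arcs_support E)"
    using VE(1) unfolding arc_network_def by blast+
  let ?G = "V \<union> (\<Union>(a, b, C)\<in>E. closed_segment a b)"
  have "hausdorff1 K \<le> hausdorff1 ?G"
    using straightened_network_connected[OF conn] ends VE(2) by (intro shortest) auto
  also have "\<dots> \<le> hausdorff1 V + hausdorff1 (\<Union>(a, b, C)\<in>E. closed_segment a b)" by (rule hausdorff1_Un_le)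
  also have "\<dots> = hausdorff1 (\<Union>(a, b, C)\<in>E. closed_segment a b)" using finVE by (simp add: hausdorff1_finite)
  also have "\<dots> \<le> (\<Sum>e\<in>E. hausdorff1 (case e of (a, b, C) \<Rightarrow> closed_segment a b))"
    by (rule hausdorff1_UN_le) (rule finVE)
  also have "\<dots> \<le> (\<Sum>(a, b, C)\<in>E. ennreal (dist a b))"
    by (intro sum_mono) (auto intro: hausdorff1_closed_segment_le split: prod.split)
  finally have K_le: "hausdorff1 K \<le> (\<Sum>(a, b, C)\<in>E. ennreal (dist a b))" .
  have supp_le: "hausdorff1 (arcs_support E) \<le> hausdorff1 K" using VE(4) by (rule hausdorff1_mono)
  have straight: "C = closed_segment a b" if e: "(a, b, C) \<in> E" for a b C
  proof (rule arc_between_straight)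
    show "arc_between a b C" using ends[OF e] by blast
    let ?c = "\<lambda>(a, b, C). enn2real (hausdorff1 C)" and ?l = "\<lambda>(a, b, C). dist a b"
    have C_fin: "hausdorff1 C' < top" if "(a', b', C') \<in> E" for a' b' C'
    proof -
      have "hausdorff1 C' \<le> hausdorff1 K"
        using that VE(4) by (intro hausdorff1_mono) (auto simp: arcs_support_def)
      then show ?thesis using fin by (simp add: less_top[symmetric] top_unique) (metis top_unique)
    qed
    have "ennreal (\<Sum>e\<in>E. ?c e) = (\<Sum>(a, b, C)\<in>E. hausdorff1 C)"
      by (subst sum_ennreal[symmetric]) (use C_fin in \<open>fastforce intro!: sum.cong split: prod.splits\<close>)+
    also have "\<dots> \<le> (\<Sum>(a, b, C)\<in>E. ennreal (dist a b))"
      using len supp_le K_le by order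
    also have "\<dots> = ennreal (\<Sum>e\<in>E. ?l e)"
      by (subst sum_ennreal[symmetric]) (fastforce intro!: sum.cong split: prod.splits)+
    finally have total: "(\<Sum>e\<in>E. ?c e) \<le> (\<Sum>e\<in>E. ?l e)"
      by (subst (asm) ennreal_le_iff) (auto intro!: sum_nonneg)
    have each: "?l e' \<le> ?c e'" if "e' \<in> E" for e'
    proof -
      obtain a' b' C' where e': "e' = (a', b', C')" by (cases e')
      have "ennreal (dist a' b') \<le> hausdorff1 C'"
        using ends that e' hausdorff1_arc_between_ge by blast
      then show ?thesis using C_fin that e'
        by (metis (mono_tags, lifting) case_prod_conv enn2real_ennreal enn2real_mono zero_le_dist)
    qed
    have "?c (a, b, C) \<le> ?l (a, b, C)"
    proof (rule ccontr)
      assume "\<not> ?thesis"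
      then have "(\<Sum>e\<in>E. ?l e) < (\<Sum>e\<in>E. ?c e)"
        using e each by (intro sum_strict_mono_ex1 finVE) (auto intro!: bexI[of _ "(a, b, C)"])
      then show False using total by simp
    qed
    then show "hausdorff1 C \<le> ennreal (dist a b)"
      using C_fin[OF e] by (metis case_prod_conv ennreal_enn2real ennreal_leI)
  qed
  define F where "F = (\<lambda>(a, b, C). (a, b)) ` E"
  have supp: "arcs_support E = (\<Union>(a, b)\<in>F. closed_segment a b)"
  proof -
    have "arcs_support E = (\<Union>(a, b, C)\<in>E. closed_segment a b)"
      unfolding arcs_support_def by (intro SUP_cong refl) (use straight in auto)
    then show ?thesis by (simp add: F_def case_prod_unfold)
  qed
  have "K \<subseteq> T \<union> arcs_support E"
  proof
    let ?W = "T \<union> arcs_support E"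
    fix p assume p: "p \<in> K"
    show "p \<in> ?W"
    proof (rule ccontr)
      assume np: "p \<notin> ?W"
      have clos: "closed ?W" using closed_arcs_support[OF VE(1)] T(1) by (auto intro: finite_imp_closed)
      then obtain r where r: "0 < r" "ball p r \<subseteq> - ?W"
        using np by (metis Compl_iff open_Compl open_contains_ball)
      obtain t where t: "t \<in> T" using T(2) by blast
      then have "r \<le> dist p t" using r(2) by (auto simp: subset_iff not_less[symmetric])
      then have "ennreal r \<le> hausdorff1 (K \<inter> ball p r)"
        using K(1) p t T(3) r(1) by (intro hausdorff1_Int_ball_ge) auto
      also have "\<dots> \<le> hausdorff1 (K - ?W)" using r(2) by (intro hausdorff1_mono) auto
      finally have "hausdorff1 (arcs_support E) + ennreal r \<le> hausdorff1 (K \<inter> ?W) + hausdorff1 (K - ?W)"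
        using VE(4) by (intro add_mono hausdorff1_mono) auto
      also have "\<dots> = hausdorff1 K" by (rule hausdorff1_split[OF clos, symmetric])
      also have "\<dots> \<le> (\<Sum>(a, b, C)\<in>E. ennreal (dist a b))" by (rule K_le)
      also have "\<dots> \<le> (\<Sum>(a, b, C)\<in>E. hausdorff1 C)"
        by (intro sum_mono) (use ends hausdorff1_arc_between_ge in \<open>fastforce split: prod.split\<close>)
      also have "\<dots> \<le> hausdorff1 (arcs_support E)" by (rule len)
      finally have "hausdorff1 (arcs_support E) + ennreal r \<le> hausdorff1 (arcs_support E)" .
      moreover have "hausdorff1 (arcs_support E) < top" using le_less_trans[OF supp_le fin] by simp
      ultimately show False using r(1)
        by (cases "hausdorff1 (arcs_support E)" rule: ennreal_cases)
           (auto simp: ennreal_plus[symmetric] simp del: ennreal_plus)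
    qed
  qed
  then have "K = T \<union> (\<Union>(a, b)\<in>F. closed_segment a b)" using VE(4) T(3) supp by blast
  moreover have "card F \<le> 2 * card T"
    unfolding F_def using card_image_le[OF finVE(2)] VE(6) order_trans by blast
  moreover have "F \<subseteq> V \<times> V" "finite F" using ends finVE by (auto simp: F_def)
  ultimately show ?thesis using that finVE(1) VE(5) by blast
qed

section \<open>Connecting points on a sphere\<close>

lemma power_Suc_diff_le:
  fixes x y :: real
  assumes "0 \<le> y" "y \<le> x"
  shows "x ^ Suc q - y ^ Suc q \<le> (x - y) * real (Suc q) * x ^ q"
proof (induction q)
  case (Suc q)
  have "x ^ Suc (Suc q) - y ^ Suc (Suc q) = x * (x ^ Suc q - y ^ Suc q) + (x - y) * y ^ Suc q"
    by (simp add: algebra_simps)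
  also have "\<dots> \<le> x * ((x - y) * real (Suc q) * x ^ q) + (x - y) * x ^ Suc q"
    using assms Suc by (intro add_mono mult_left_mono power_mono) auto
  also have "\<dots> = (x - y) * real (Suc (Suc q)) * x ^ Suc q" by (simp add: algebra_simps)
  finally show ?case .
qed simp

text \<open>The balls of radius \<open>\<eta> = \<epsilon> / 2\<close> around the points are disjoint and lie in a spherical shell of
  thickness \<open>2 \<eta>\<close>.  Comparing volumes in the shell, and not in the whole ball, gives the exponent
  \<open>q\<close>, which is one less than the dimension.\<close>

lemma sphere_packing:
  fixes P :: "'a::euclidean_space set"
  assumes P: "finite P" "P \<subseteq> sphere x r" and \<epsilon>: "0 < \<epsilon>" "\<epsilon> \<le> 2 * r"
    and sep: "\<And>p p'. p \<in> P \<Longrightarrow> p' \<in> P \<Longrightarrow> p \<noteq> p' \<Longrightarrow> \<epsilon> \<le> dist p p'"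
    and dim: "DIM('a) = Suc q"
  shows "real (card P) * \<epsilon> ^ q \<le> 2 * real (Suc q) * (4 * r) ^ q"
proof -
  define \<eta> where "\<eta> = \<epsilon> / 2"
  have \<eta>: "0 < \<eta>" "\<eta> \<le> r" using \<epsilon> by (auto simp: \<eta>_def)
  define v where "v = unit_ball_vol (real DIM('a))"
  have v: "0 < v" by (simp add: v_def)
  have vol: "measure lebesgue (ball c t) = v * t ^ Suc q" if "0 \<le> t" for c :: 'a and t
    using content_ball[OF that, of c] by (simp add: v_def dim)
  have sub: "(\<Union>p\<in>P. ball p \<eta>) \<subseteq> ball x (r + \<eta>) - ball x (r - \<eta>)"
  proof
    fix z assume "z \<in> (\<Union>p\<in>P. ball p \<eta>)"
    then obtain p where p: "p \<in> P" "dist p z < \<eta>" by auto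
    have "dist x p = r" using P(2) p(1) by auto
    then show "z \<in> ball x (r + \<eta>) - ball x (r - \<eta>)"
      using p(2) dist_triangle[of x z p] dist_triangle[of x p z] by (auto simp: dist_commute)
  qed
  have "real (card P) * (v * \<eta> ^ Suc q) = (\<Sum>p\<in>P. measure lebesgue (ball p \<eta>))"
    using vol \<eta> by simp
  also have "\<dots> = measure lebesgue (\<Union>p\<in>P. ball p \<eta>)"
  proof (rule measure_UNION'[symmetric])
    show "pairwise (\<lambda>p p'. disjnt (ball p \<eta>) (ball p' \<eta>)) P"
      unfolding pairwise_def
    proof (intro ballI impI)
      fix p p' assume "p \<in> P" "p' \<in> P" "p \<noteq> p'"
      then have "\<eta> + \<eta> \<le> dist p p'" using sep by (simp add: \<eta>_def)
      then show "disjnt (ball p \<eta>) (ball p' \<eta>)" by (simp add: disjnt_def disjoint_ballI)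
    qed
  qed (use P in auto)
  also have "\<dots> \<le> measure lebesgue (ball x (r + \<eta>) - ball x (r - \<eta>))"
    using sub P(1) by (intro measure_mono_fmeasurable) (auto intro: fmeasurable.Diff)
  also have "\<dots> = measure lebesgue (ball x (r + \<eta>)) - measure lebesgue (ball x (r - \<eta>))"
    using \<eta> by (intro measurable_measure_Diff) (auto intro: subset_ball)
  also have "\<dots> = v * ((r + \<eta>) ^ Suc q - (r - \<eta>) ^ Suc q)"
    using vol \<eta> by (simp add: algebra_simps)
  finally have "real (card P) * \<eta> ^ Suc q \<le> (r + \<eta>) ^ Suc q - (r - \<eta>) ^ Suc q"
    using v by (simp add: mult.left_commute)
  also have "\<dots> \<le> (r + \<eta> - (r - \<eta>)) * real (Suc q) * (r + \<eta>) ^ q"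
    using \<eta> by (intro power_Suc_diff_le) auto
  also have "\<dots> \<le> (r + \<eta> - (r - \<eta>)) * real (Suc q) * (2 * r) ^ q"
    using \<eta> by (intro mult_left_mono power_mono) auto
  finally have "\<eta> * (real (card P) * \<eta> ^ q) \<le> \<eta> * (2 * real (Suc q) * (2 * r) ^ q)"
    by (simp add: algebra_simps)
  then have "real (card P) * \<eta> ^ q \<le> 2 * real (Suc q) * (2 * r) ^ q"
    using \<eta>(1) by (simp only: mult_le_cancel_left_pos)
  then have "2 ^ q * (real (card P) * \<eta> ^ q) \<le> 2 ^ q * (2 * real (Suc q) * (2 * r) ^ q)"
    by (intro mult_left_mono) auto
  moreover have "\<epsilon> ^ q = 2 ^ q * \<eta> ^ q" by (simp add: \<eta>_def power_divide)
  moreover have "(4 * r) ^ q = 2 ^ q * (2 * r) ^ q"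
    using power_mult_distrib[of 2 "2 * r" q] by simp
  ultimately show ?thesis by (simp only: mult_ac)
qed

lemma sphere_close_pair:
  fixes P :: "'a::euclidean_space set"
  assumes P: "finite P" "P \<subseteq> sphere x r" "2 \<le> card P" and dim: "DIM('a) = Suc q" "2 \<le> q"
  obtains p p' where "p \<in> P" "p' \<in> P" "p \<noteq> p'" "dist p p' \<le> 10 * r / root q (card P)"
proof -
  define D where "D = (\<lambda>(p, p'). dist p p') ` (P \<times> P - Id)"
  have fin: "finite D" using P(1) by (simp add: D_def)
  have "\<not> is_singleton P" "P \<noteq> {}" using P(3) by (auto simp: is_singleton_altdef)
  then obtain a b where "a \<in> P" "b \<in> P" "a \<noteq> b" by (metis is_singletonI' ex_in_conv)
  then have ne: "D \<noteq> {}" by (auto simp: D_def)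
  have "\<forall>d\<in>D. \<exists>p p'. p \<in> P \<and> p' \<in> P \<and> p \<noteq> p' \<and> dist p p' = d" by (auto simp: D_def)
  then obtain p p' where p: "p \<in> P" "p' \<in> P" "p \<noteq> p'" "dist p p' = Min D"
    using Min_in[OF fin ne] by blast
  define \<epsilon> where "\<epsilon> = dist p p'"
  have \<epsilon>0: "0 < \<epsilon>" unfolding \<epsilon>_def using p(3) by simp
  have \<epsilon>r: "\<epsilon> \<le> 2 * r"
    using dist_triangle3[of p p' x] p(1,2) P(2) by (auto simp: \<epsilon>_def subset_iff)
  have "\<epsilon> \<le> dist a b" if "a \<in> P" "b \<in> P" "a \<noteq> b" for a b
    unfolding \<epsilon>_def p(4) using that fin by (intro Min_le) (auto simp: D_def)
  then have pack: "real (card P) * \<epsilon> ^ q \<le> 2 * real (Suc q) * (4 * r) ^ q"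
    by (intro sphere_packing[OF P(1,2) \<epsilon>0 \<epsilon>r _ dim(1)])
  \<comment> \<open>this turns the factor 4 of the packing bound into the constant 10\<close>
  have base: "2 * real (Suc q) \<le> (5 / 2) ^ q"
    using dim(2)
  proof (induction q rule: nat_induct_at_least)
    case (Suc q)
    then have "2 * real (Suc (Suc q)) \<le> (5 / 2) * (2 * real (Suc q))" by simp
    also have "\<dots> \<le> (5 / 2) * (5 / 2) ^ q" using Suc by (intro mult_left_mono) auto
    finally show ?case by simp
  qed (simp add: power2_eq_square)
  define u where "u = root q (card P)"
  have u: "0 < u" "u ^ q = real (card P)" using P(3) dim(2) by (auto simp: u_def)
  have "(u * \<epsilon>) ^ q \<le> 2 * real (Suc q) * (4 * r) ^ q" using pack u by (simp add: power_mult_distrib)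
  also have "\<dots> \<le> (5 / 2) ^ q * (4 * r) ^ q"
    using base \<epsilon>0 \<epsilon>r by (intro mult_right_mono) auto
  also have "\<dots> = (5 / 2 * (4 * r)) ^ q" by (rule power_mult_distrib[symmetric])
  also have "5 / 2 * (4 * r) = 10 * r" by simp
  finally have "u * \<epsilon> \<le> 10 * r"
    using u \<epsilon>0 \<epsilon>r dim(2) by (subst (asm) power_mono_iff) auto
  then have "\<epsilon> \<le> 10 * r / u" using u(1) by (simp add: field_simps)
  then show ?thesis using p that unfolding u_def \<epsilon>_def by blast
qed

text \<open>The induction step for bounding the sum of \<open>10 / root q k\<close> over \<open>k \<le> n\<close> by \<open>20 n / root q n\<close>.\<close>

lemma root_sum_step:
  assumes "1 \<le> n" "2 \<le> q"
  shows "20 * real n / root q n + 10 / root q (Suc n) \<le> 20 * real (Suc n) / root q (Suc n)"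
proof -
  define u v where "u = root q n" and "v = root q (Suc n)"
  have u: "0 < u" "u ^ q = real n" and v: "0 < v" "v ^ q = real (Suc n)"
    using assms by (auto simp: u_def v_def)
  have "(v / u) ^ q = 1 + 1 / n" using u v assms by (simp add: power_divide field_simps)
  also have "\<dots> \<le> 1 + real q * (1 / (2 * n))" using assms by (simp add: field_simps)
  also have "\<dots> \<le> (1 + 1 / (2 * n)) ^ q" by (rule Bernoulli_inequality) (rule order_trans[of _ 0], auto)
  finally have "v / u \<le> 1 + 1 / (2 * n)"
    using u v assms by (subst (asm) power_mono_iff) auto
  then have "20 * real n * (v / u) \<le> 20 * real n * (1 + 1 / (2 * n))" by (intro mult_left_mono) auto
  also have "\<dots> = 20 * n + 10" using assms by (simp add: field_simps)
  finally have "(20 * real n * (v / u) + 10) / v \<le> 20 * real (Suc n) / v"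
    using v by (intro divide_right_mono) auto
  then show ?thesis using v unfolding u_def[symmetric] v_def[symmetric]
    by (simp add: add_divide_distrib)
qed

text \<open>Two closest points are joined by a segment and one of them is dropped, until a single point is left.
  The segment that is added when \<open>k\<close> points are left has length at most \<open>10 r / root q k\<close>.\<close>

lemma connect_points_on_sphere:
  fixes P :: "'a::euclidean_space set"
  assumes "finite P" "P \<noteq> {}" "P \<subseteq> sphere x r" "0 \<le> r" and dim: "DIM('a) = Suc q" "2 \<le> q"
  obtains G where "connected G" "P \<subseteq> G"
    "hausdorff1 G \<le> ennreal (20 * r * real (card P) / root q (card P))"
proof -
  have "\<exists>G. connected G \<and> P \<subseteq> G \<and> hausdorff1 G \<le> ennreal (20 * r * real n / root q n)"
    if "n = card P" "1 \<le> n" "finite P" "P \<subseteq> sphere x r" for n P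
    using that(2,1,3,4)
  proof (induction n arbitrary: P rule: nat_induct_at_least)
    case base
    then obtain p where "P = {p}" by (metis card_1_singletonE)
    then show ?case by (intro exI[of _ "{p}"]) auto
  next
    case (Suc n)
    have "2 \<le> card P" using Suc by simp
    then obtain p p' where p: "p \<in> P" "p' \<in> P" "p \<noteq> p'" "dist p p' \<le> 10 * r / root q (Suc n)"
      unfolding Suc.prems(1) by (rule sphere_close_pair[OF Suc.prems(2,3) _ dim])
    obtain G where G: "connected G" "P - {p} \<subseteq> G" "hausdorff1 G \<le> ennreal (20 * r * real n / root q n)"
    proof -
      have "n = card (P - {p})" using Suc.prems(1,2) p(1) by (metis card_Diff_singleton diff_Suc_1)
      moreover have "finite (P - {p})" "P - {p} \<subseteq> sphere x r" using Suc.prems(2,3) by auto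
      ultimately show ?thesis using Suc.IH that by blast
    qed
    have "connected (G \<union> closed_segment p p')"
      using G p by (intro connected_Un) auto
    moreover have "P \<subseteq> G \<union> closed_segment p p'" using G(2) by auto
    moreover have "hausdorff1 (G \<union> closed_segment p p') \<le> ennreal (20 * r * real (Suc n) / root q (Suc n))"
    proof -
      have "hausdorff1 (G \<union> closed_segment p p') \<le> hausdorff1 G + hausdorff1 (closed_segment p p')"
        by (rule hausdorff1_Un_le)
      also have "\<dots> \<le> ennreal (20 * r * real n / root q n) + ennreal (10 * r / root q (Suc n))"
        using p(4) by (intro add_mono G order_trans[OF hausdorff1_closed_segment_le] ennreal_leI)
      also have "\<dots> = ennreal (r * (20 * real n / root q n + 10 / root q (Suc n)))"
        using \<open>0 \<le> r\<close> dim(2) by (subst ennreal_plus[symmetric]) (auto simp: algebra_simps)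
      also have "\<dots> \<le> ennreal (r * (20 * real (Suc n) / root q (Suc n)))"
        using \<open>0 \<le> r\<close> root_sum_step[OF Suc.hyps dim(2)] by (intro ennreal_leI mult_left_mono)
      finally show ?thesis by (simp add: algebra_simps)
    qed
    ultimately show ?case by blast
  qed
  moreover have "1 \<le> card P" using assms by (simp add: Suc_le_eq card_gt_0_iff)
  ultimately show ?thesis using assms that by blast
qed

section \<open>Local minimality of Steiner sets\<close>

text \<open>In a separation of the new set, \<open>G\<close> lies on one side.  The hypothesis on \<open>W\<close> says that every point of
  \<open>K\<close> which is lost is interior to \<open>K\<close> relative to \<open>X\<close>; adding these points to the side of \<open>G\<close> therefore
  gives a separation of \<open>X\<close>.\<close>

lemma connected_replace_part:
  fixes X :: "'a::topological_space set"
  assumes X: "connected X" and K: "closed K" and G: "connected G" "G \<inter> X \<noteq> {}"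
    and W: "open W" "K - G \<subseteq> W" "W \<inter> X \<subseteq> K"
  shows "connected ((X - K) \<union> G)" (is "connected ?Z")
proof (rule connectedI)
  have no: False
    if AB: "open A" "open B" "A \<inter> ?Z \<noteq> {}" "B \<inter> ?Z \<noteq> {}" "A \<inter> B \<inter> ?Z = {}" "?Z \<subseteq> A \<union> B"
      and GA: "G \<subseteq> A" for A B
  proof -
    have "(A \<union> W) \<inter> X = {} \<or> (B - K) \<inter> X = {}"
    proof (rule connectedD[OF X])
      show "open (A \<union> W)" "open (B - K)" using AB W K by auto
      show "(A \<union> W) \<inter> (B - K) \<inter> X = {}" using AB(5) W(3) by blast
      show "X \<subseteq> (A \<union> W) \<union> (B - K)" using AB(6) GA W(2) by blast
    qed
    moreover have "(A \<union> W) \<inter> X \<noteq> {}" using GA G(2) by blast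
    moreover have "(B - K) \<inter> X \<noteq> {}" using AB(4,5) GA by blast
    ultimately show False by blast
  qed
  fix A B
  assume AB: "open A" "open B" "A \<inter> ?Z \<noteq> {}" "B \<inter> ?Z \<noteq> {}" "A \<inter> B \<inter> ?Z = {}" "?Z \<subseteq> A \<union> B"
  then have "A \<inter> G = {} \<or> B \<inter> G = {}" using connectedD[OF G(1), of A B] by blast
  then have "G \<subseteq> B \<or> G \<subseteq> A" using AB(6) by blast
  then show False using no[of A B] no[of B A] AB by (auto simp: Int_commute Un_commute)
qed

lemma steiner_set_part_minimal:
  assumes S: "steiner_set A S" "hausdorff1 S < \<infinity>"
    and K: "closed K" "K \<subseteq> S" "K \<inter> A = {}" and G: "connected G" "G \<inter> S \<noteq> {}"
    and W: "open W" "K - G \<subseteq> W" "W \<inter> (S \<union> A) \<subseteq> K"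
  shows "hausdorff1 K \<le> hausdorff1 G"
proof -
  have "connected (((S \<union> A) - K) \<union> G)"
    using S(1) K(1) G W unfolding steiner_set_def by (intro connected_replace_part[of _ _ _ W]) auto
  moreover have "((S \<union> A) - K) \<union> G = ((S - K) \<union> G) \<union> A" using K(3) by blast
  ultimately have "hausdorff1 S \<le> hausdorff1 ((S - K) \<union> G)"
    using S(1) unfolding steiner_set_def by simp
  also have "\<dots> \<le> hausdorff1 (S - K) + hausdorff1 G" by (rule hausdorff1_Un_le)
  finally have le: "hausdorff1 S \<le> hausdorff1 (S - K) + hausdorff1 G" .
  have "hausdorff1 S = hausdorff1 (S - K) + hausdorff1 K"
    using hausdorff1_split[OF K(1), of S] K(2) by (simp add: Int_absorb1 add.commute)
  moreover have "hausdorff1 (S - K) \<noteq> \<infinity>"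
    using S(2) hausdorff1_mono[of "S - K" S] by auto
  ultimately show ?thesis using le by (simp add: ennreal_add_left_cancel_le)
qed

text \<open>Boundary bumping: a component inside the open ball would, by the Sura-Bura theorem, be contained in
  a relatively clopen subset of \<open>S \<inter> cball x r\<close> that still lies in the open ball.  That subset would be
  clopen in \<open>S\<close>.\<close>

lemma component_in_cball_meets_sphere:
  fixes S :: "'a::euclidean_space set"
  assumes S: "connected S" "closed S" and p: "p \<in> S" "r \<le> dist x p"
    and C: "C \<in> components (S \<inter> cball x r)"
  shows "C \<inter> sphere x r \<noteq> {}"
proof
  assume none: "C \<inter> sphere x r = {}"
  let ?X = "S \<inter> cball x r"
  have X: "compact ?X" using S(2) by (intro closed_Int_compact) auto
  have "C \<subseteq> ?X" using C by (rule in_components_subset)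
  then have "C \<subseteq> ball x r" using none by (auto simp: subset_iff less_le)
  moreover have "locally compact ?X" by (rule closed_imp_locally_compact[OF compact_imp_closed[OF X]])
  ultimately obtain K where K: "openin (top_of_set ?X) K" "compact K" "C \<subseteq> K" "K \<subseteq> ball x r"
    using Sura_Bura_clopen_subset[OF _ C compact_components[OF X C] open_ball] by metis
  obtain W where W: "open W" "K = ?X \<inter> W" using K(1) by (auto simp: openin_open)
  have "ball x r \<subseteq> cball x r" by auto
  then have "K = S \<inter> (W \<inter> ball x r)" using W(2) K(4) by blast
  then have "openin (top_of_set S) K" using openin_open_Int[OF open_Int[OF W(1) open_ball]] by metis
  moreover have "closedin (top_of_set S) K"
    using K(2) W(2) by (intro closed_subset compact_imp_closed) auto
  moreover have "K \<noteq> {}" using K(3) in_components_nonempty[OF C] by blast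
  ultimately have "K = S" using S(1) unfolding connected_clopen by blast
  then show False using K(4) p by auto
qed

lemma finite_components_meeting:
  assumes "finite P" "\<And>C. C \<in> components X \<Longrightarrow> C \<inter> P \<noteq> {}"
  shows "finite (components X)"
proof (rule finite_subset)
  show "components X \<subseteq> connected_component_set X ` P"
  proof
    fix C assume C: "C \<in> components X"
    then obtain p where "p \<in> C" "p \<in> P" using assms(2) by blast
    obtain q where "C = connected_component_set X q" using C by (auto simp: components_iff)
    then have "C = connected_component_set X p"
      using connected_component_eq[of p X q] \<open>p \<in> C\<close> by blast
    then show "C \<in> connected_component_set X ` P" using \<open>p \<in> P\<close> by blast
  qed
qed (use assms(1) in simp)

text \<open>There are finitely many components of \<open>S\<close> in the closed ball, since each contains a point on the sphere.
  Hence each is relatively open, its points off the sphere are interior to it relative to \<open>S\<close>, and it may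
  be exchanged for any connected set through its points on the sphere.\<close>

lemma steiner_set_in_ball_is_union_of_segments:
  fixes A S :: "'a::euclidean_space set"
  assumes S: "steiner_set A S" "connected S" "hausdorff1 S < \<infinity>"
    and A: "cball x r \<inter> A = {}" and P: "finite (S \<inter> sphere x r)" "S \<inter> sphere x r \<noteq> {}"
  obtains V F where "finite V" "card V \<le> 2 * card (S \<inter> sphere x r)"
    "finite F" "card F \<le> 2 * card (S \<inter> sphere x r)" "F \<subseteq> V \<times> V"
    "S \<inter> ball x r = (\<Union>(a, b)\<in>F. closed_segment a b) \<inter> ball x r"
proof -
  define X where "X = S \<inter> cball x r"
  define P where "P = S \<inter> sphere x r"
  have clS: "closed S" using S(1) by (simp add: steiner_set_def)
  have compX: "compact X" unfolding X_def using clS by (intro closed_Int_compact) auto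
  obtain p where p: "p \<in> S" "dist x p = r" using P(2) by (metis IntE ex_in_conv mem_sphere)
  have meets: "C \<inter> P \<noteq> {}" if "C \<in> components X" for C
    using component_in_cball_meets_sphere[OF S(2) clS p(1) _ that[unfolded X_def]] p(2)
      in_components_subset[OF that] by (auto simp: P_def X_def)
  have finC: "finite (components X)"
    using P(1) meets unfolding P_def by (rule finite_components_meeting)
  define good where "good C V F \<longleftrightarrow> finite V \<and> card V \<le> 2 * card (C \<inter> P) \<and>
      finite F \<and> card F \<le> 2 * card (C \<inter> P) \<and> F \<subseteq> V \<times> V \<and>
      C = (C \<inter> P) \<union> (\<Union>(a, b)\<in>F. closed_segment a b)" for C and V :: "'a set" and F
  have "\<exists>V F. good C V F"
    if C: "C \<in> components X" for C
  proof -
    have sub: "C \<subseteq> X" using C by (rule in_components_subset)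
    have comp: "compact C" using compact_components[OF compX C] .
    have fin: "hausdorff1 C < \<infinity>"
      using hausdorff1_mono[of C S] sub S(3) by (auto simp: X_def)
    define W where "W = ball x r - \<Union>(components X - {C})"
    have "closed (\<Union>(components X - {C}))"
      using finC compact_components[OF compX] by (intro closed_Union) (auto intro: compact_imp_closed)
    then have "open W" unfolding W_def by (intro open_Diff) auto
    have shortest: "hausdorff1 C \<le> hausdorff1 G" if G: "connected G" "C \<inter> P \<subseteq> G" for G
    proof (rule steiner_set_part_minimal[OF S(1,3)])
      show "closed C" using comp by (rule compact_imp_closed)
      show "C \<subseteq> S" "C \<inter> A = {}" using sub A by (auto simp: X_def)
      show "G \<inter> S \<noteq> {}" using G(2) meets[OF C] by (auto simp: P_def)
      show "C - G \<subseteq> W"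
      proof
        fix z assume z: "z \<in> C - G"
        then have "z \<in> ball x r" using sub G(2) by (auto simp: X_def P_def less_le)
        moreover have "z \<notin> C'" if "C' \<in> components X" "C' \<noteq> C" for C'
          using components_nonoverlap[OF C that(1)] that(2) z by blast
        ultimately show "z \<in> W" by (auto simp: W_def)
      qed
      show "W \<inter> (S \<union> A) \<subseteq> C"
      proof
        fix z assume z: "z \<in> W \<inter> (S \<union> A)"
        then have "z \<in> cball x r" by (auto simp: W_def)
        then have "z \<in> X" using z A by (auto simp: X_def)
        then obtain C' where "C' \<in> components X" "z \<in> C'" using Union_components[of X] by blast
        then show "z \<in> C" using z by (auto simp: W_def)
      qed
    qed fact+
    obtain V F where "finite V" "card V \<le> 2 * card (C \<inter> P)" "finite F" "card F \<le> 2 * card (C \<inter> P)"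
        "F \<subseteq> V \<times> V" "C = (C \<inter> P) \<union> (\<Union>(a, b)\<in>F. closed_segment a b)"
      using shortest_continuum_is_union_of_segments[OF in_components_connected[OF C] comp fin,
          of "C \<inter> P"] P(1) meets[OF C] shortest unfolding P_def by auto
    then have "good C V F" unfolding good_def by blast
    then show ?thesis by blast
  qed
  then obtain V F where good: "\<And>C. C \<in> components X \<Longrightarrow> good C (V C) (F C)" by metis
  have VF: "\<And>C. C \<in> components X \<Longrightarrow> finite (V C)"
      "\<And>C. C \<in> components X \<Longrightarrow> card (V C) \<le> 2 * card (C \<inter> P)"
      "\<And>C. C \<in> components X \<Longrightarrow> finite (F C)"
      "\<And>C. C \<in> components X \<Longrightarrow> card (F C) \<le> 2 * card (C \<inter> P)"
      "\<And>C. C \<in> components X \<Longrightarrow> F C \<subseteq> V C \<times> V C"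
      "\<And>C. C \<in> components X \<Longrightarrow> C = (C \<inter> P) \<union> (\<Union>(a, b)\<in>F C. closed_segment a b)"
    using good unfolding good_def by blast+
  have total: "(\<Sum>C\<in>components X. card (C \<inter> P)) = card P"
  proof -
    have "(\<Sum>C\<in>components X. card (C \<inter> P)) = card (\<Union>C\<in>components X. C \<inter> P)"
    proof (rule card_UN_disjoint[symmetric, OF finC])
      show "\<forall>C\<in>components X. finite (C \<inter> P)" using P(1) by (simp add: P_def)
      show "\<forall>C\<in>components X. \<forall>C'\<in>components X. C \<noteq> C' \<longrightarrow> C \<inter> P \<inter> (C' \<inter> P) = {}"
        using components_nonoverlap by blast
    qed
    also have "(\<Union>C\<in>components X. C \<inter> P) = P"
    proof -
      have "P \<subseteq> X" by (auto simp: P_def X_def)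
      then show ?thesis using Union_components[of X] by blast
    qed
    finally show ?thesis .
  qed
  have count: "card (\<Union>C\<in>components X. g C) \<le> 2 * card P"
    if "\<And>C. C \<in> components X \<Longrightarrow> card (g C) \<le> 2 * card (C \<inter> P)" for g :: "'a set \<Rightarrow> 'b set"
  proof -
    have "card (\<Union>C\<in>components X. g C) \<le> (\<Sum>C\<in>components X. card (g C))"
      by (rule card_UN_le[OF finC])
    also have "\<dots> \<le> (\<Sum>C\<in>components X. 2 * card (C \<inter> P))" using that by (rule sum_mono)
    also have "\<dots> = 2 * card P" using total by (simp flip: sum_distrib_left)
    finally show ?thesis .
  qed
  show ?thesis
  proof
    show "finite (\<Union>C\<in>components X. V C)" "finite (\<Union>C\<in>components X. F C)" using finC VF by auto
    show "card (\<Union>C\<in>components X. V C) \<le> 2 * card (S \<inter> sphere x r)"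
      using count[of V] VF(2) by (simp add: P_def)
    show "card (\<Union>C\<in>components X. F C) \<le> 2 * card (S \<inter> sphere x r)"
      using count[of F] VF(4) by (simp add: P_def)
    show "(\<Union>C\<in>components X. F C) \<subseteq> (\<Union>C\<in>components X. V C) \<times> (\<Union>C\<in>components X. V C)"
      using VF(5) by blast
    have "S \<inter> ball x r = (\<Union>C\<in>components X. C) \<inter> ball x r"
    proof -
      have "ball x r \<subseteq> cball x r" by auto
      then show ?thesis using Union_components[of X] unfolding X_def by blast
    qed
    also have "\<dots> = (\<Union>C\<in>components X. \<Union>(a, b)\<in>F C. closed_segment a b) \<inter> ball x r"
    proof -
      have "C \<inter> ball x r = (\<Union>(a, b)\<in>F C. closed_segment a b) \<inter> ball x r" if "C \<in> components X" for C
        using VF(6)[OF that] by (auto simp: P_def)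
      then show ?thesis by blast
    qed
    finally show "S \<inter> ball x r = (\<Union>(a, b)\<in>(\<Union>C\<in>components X. F C). closed_segment a b) \<inter> ball x r"
      by (simp add: UN_UN_flatten)
  qed
qed

section \<open>Branching points\<close>

lemma convex_subset_of_segment:
  fixes T :: "'a::euclidean_space set"
  assumes T: "convex T" "T \<subseteq> closed_segment a b"
  shows "line_segment T"
proof (cases "T = {}")
  case True
  then show ?thesis unfolding line_segment_def by (intro exI[of _ a]) auto
next
  case False
  have sub: "closure T \<subseteq> closed_segment a b" using T(2) by (intro closure_minimal) auto
  then have "compact (closure T)"
    using bounded_subset[OF _ sub] by (simp add: compact_eq_bounded_closed bounded_closed_segment)
  moreover have "collinear (closure T)"
    using sub collinear_closed_segment collinear_subset by blast
  ultimately obtain c d where cd: "closure T = closed_segment c d"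
    using compact_convex_collinear_segment[of "closure T"] False convex_closure[OF T(1)] by auto
  have "open_segment c d \<subseteq> rel_interior (closure T)"
    unfolding cd by (simp add: rel_interior_closed_segment)
  also have "\<dots> \<subseteq> T"
    using convex_rel_interior_closure[OF T(1)] rel_interior_subset by blast
  finally show ?thesis unfolding line_segment_def using cd closure_subset by blast
qed

lemma vec_angle_opposite:
  assumes "u \<noteq> 0" "0 < c"
  shows "vec_angle u (- (c *\<^sub>R u)) = pi" "vec_angle (- (c *\<^sub>R u)) u = pi"
proof -
  have "inner u (- (c *\<^sub>R u)) / (norm u * norm (- (c *\<^sub>R u))) = - 1"
    using assms by (simp add: dot_square_norm power2_eq_square)
  then show "vec_angle u (- (c *\<^sub>R u)) = pi" "vec_angle (- (c *\<^sub>R u)) u = pi"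
    unfolding vec_angle_def by (simp_all add: inner_commute mult.commute)
qed

text \<open>The reflection of a point on one leg lies on the opposite ray, which makes the angle \<open>\<pi>\<close> with that
  leg; no other leg lies on this ray, as it makes the angle \<open>2 * \<pi> / 3\<close>.\<close>

lemma regular_tripod_not_symmetric:
  assumes "regular_tripod y T"
  shows "\<exists>z\<in>T. 2 *\<^sub>R y - z \<notin> T"
proof -
  obtain p q r P Q R where seg: "segment_from y p P" "segment_from y q Q" "segment_from y r R"
      and T: "T = P \<union> Q \<union> R"
      and angle: "vec_angle (p - y) (q - y) = 2 * pi / 3" "vec_angle (r - y) (p - y) = 2 * pi / 3"
    using assms unfolding regular_tripod_def by blast
  define u where "u = p - y"
  have u: "u \<noteq> 0" using seg(1) by (simp add: segment_from_def u_def)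
  define z where "z = y + (1/2) *\<^sub>R u"
  have "z \<in> closed_segment y p"
    unfolding closed_segment_def z_def u_def by (auto simp: algebra_simps intro!: exI[of _ "1/2"])
  moreover have "z \<noteq> p"
  proof
    assume "z = p"
    then have "(1/2) *\<^sub>R u = 0" by (simp add: z_def u_def algebra_simps)
    then show False using u by simp
  qed
  ultimately have zT: "z \<in> T" using seg(1) by (auto simp: segment_from_def T)
  have opposite: "\<exists>c>0. e - y = - (c *\<^sub>R u)" if e: "2 *\<^sub>R y - z \<in> closed_segment y e" for e
  proof -
    obtain \<sigma> where \<sigma>: "0 \<le> \<sigma>" "2 *\<^sub>R y - z = (1 - \<sigma>) *\<^sub>R y + \<sigma> *\<^sub>R e"
      using e by (auto simp: closed_segment_def)
    have "2 *\<^sub>R y - z = y - (1/2) *\<^sub>R u" by (simp add: z_def scaleR_2)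
    then have eq: "\<sigma> *\<^sub>R (e - y) = - ((1/2) *\<^sub>R u)" using \<sigma>(2) by (simp add: algebra_simps)
    then have "\<sigma> \<noteq> 0" using u by auto
    then have "e - y = (1 / \<sigma>) *\<^sub>R (\<sigma> *\<^sub>R (e - y))" by simp
    also have "\<dots> = - ((1 / \<sigma> / 2) *\<^sub>R u)" unfolding eq by simp
    finally show ?thesis using \<sigma>(1) \<open>\<sigma> \<noteq> 0\<close> by (intro exI[of _ "1 / \<sigma> / 2"]) auto
  qed
  have "2 *\<^sub>R y - z \<notin> T"
  proof
    assume "2 *\<^sub>R y - z \<in> T"
    then consider "2 *\<^sub>R y - z \<in> closed_segment y p" | "2 *\<^sub>R y - z \<in> closed_segment y q"
      | "2 *\<^sub>R y - z \<in> closed_segment y r"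
      using seg by (auto simp: T segment_from_def)
    then show False
    proof cases
      case 1
      then obtain c where "c > 0" "u = - (c *\<^sub>R u)" using opposite u_def by metis
      then have "(1 + c) *\<^sub>R u = 0" by (metis add.commute eq_neg_iff_add_eq_0 scaleR_add_left scaleR_one)
      then show False using u \<open>c > 0\<close> by simp
    next
      case 2
      then show False using opposite[OF 2] vec_angle_opposite(1)[OF u] angle(1) by (auto simp: u_def)
    next
      case 3
      then show False using opposite[OF 3] vec_angle_opposite(2)[OF u] angle(2) by (auto simp: u_def)
    qed
  qed
  then show ?thesis using zT by blast
qed

lemma segment_locally_symmetric:
  fixes a b y :: "'a::euclidean_space"
  assumes "y \<noteq> a" "y \<noteq> b"
  shows "\<exists>\<delta>>0. \<forall>z\<in>ball y \<delta>. z \<in> closed_segment a b \<longrightarrow> 2 *\<^sub>R y - z \<in> closed_segment a b"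
proof (cases "y \<in> closed_segment a b")
  case False
  then have "open (- closed_segment a b)" "y \<in> - closed_segment a b" by auto
  then obtain \<delta> where "\<delta> > 0" "ball y \<delta> \<subseteq> - closed_segment a b"
    using open_contains_ball by blast
  then show ?thesis by blast
next
  case True
  then obtain \<tau> where \<tau>: "0 \<le> \<tau>" "\<tau> \<le> 1" "y = (1 - \<tau>) *\<^sub>R a + \<tau> *\<^sub>R b"
    by (auto simp: closed_segment_def)
  have \<tau>': "0 < \<tau>" "\<tau> < 1" using assms \<tau> by (auto simp: less_le)
  have ab: "a \<noteq> b" using \<tau>(3) assms by (auto simp: algebra_simps)
  show ?thesis
  proof (intro exI[of _ "min \<tau> (1 - \<tau>) * dist a b"] conjI ballI impI)
    show "0 < min \<tau> (1 - \<tau>) * dist a b" using \<tau>' ab by simp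
    fix z assume z: "z \<in> ball y (min \<tau> (1 - \<tau>) * dist a b)" "z \<in> closed_segment a b"
    obtain \<sigma> where \<sigma>: "z = (1 - \<sigma>) *\<^sub>R a + \<sigma> *\<^sub>R b" using z(2) by (auto simp: closed_segment_def)
    have "y - z = (\<sigma> - \<tau>) *\<^sub>R (a - b)" by (simp add: \<sigma> \<tau>(3) algebra_simps)
    then have "\<bar>\<sigma> - \<tau>\<bar> * dist a b < min \<tau> (1 - \<tau>) * dist a b"
      using z(1) by (simp add: dist_norm)
    then have "\<bar>\<sigma> - \<tau>\<bar> < min \<tau> (1 - \<tau>)" using ab by (simp add: mult_less_cancel_right)
    then have "0 \<le> 2 * \<tau> - \<sigma>" "2 * \<tau> - \<sigma> \<le> 1" by linarith+
    moreover have "2 *\<^sub>R y - z = (1 - (2 * \<tau> - \<sigma>)) *\<^sub>R a + (2 * \<tau> - \<sigma>) *\<^sub>R b"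
      by (simp add: \<sigma> \<tau>(3) algebra_simps scaleR_2)
    ultimately show "2 *\<^sub>R y - z \<in> closed_segment a b" unfolding closed_segment_def by blast
  qed
qed

text \<open>Near a point that is not an end point of any of the segments, \<open>S\<close> is symmetric about that point.\<close>

lemma branching_points_are_endpoints:
  fixes S :: "'a::euclidean_space set"
  assumes F: "finite F" "F \<subseteq> V \<times> V"
    and S: "S \<inter> ball x r = (\<Union>(a, b)\<in>F. closed_segment a b) \<inter> ball x r"
  shows "branching_points A S \<inter> ball x r \<subseteq> V"
proof
  fix y assume y: "y \<in> branching_points A S \<inter> ball x r"
  show "y \<in> V"
  proof (rule ccontr)
    assume yV: "y \<notin> V"
    obtain \<epsilon>0 where \<epsilon>0: "\<epsilon>0 > 0" "\<And>\<epsilon>. 0 < \<epsilon> \<Longrightarrow> \<epsilon> < \<epsilon>0 \<Longrightarrow> regular_tripod y (S \<inter> ball y \<epsilon>)"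
      using y by (auto simp: branching_points_def)
    have "\<forall>e\<in>F. \<exists>\<delta>>0. \<forall>z\<in>ball y \<delta>. z \<in> closed_segment (fst e) (snd e)
        \<longrightarrow> 2 *\<^sub>R y - z \<in> closed_segment (fst e) (snd e)"
      using F(2) yV by (intro ballI segment_locally_symmetric) auto
    then obtain \<delta> where \<delta>: "\<And>e. e \<in> F \<Longrightarrow> 0 < \<delta> e"
        "\<And>e z. e \<in> F \<Longrightarrow> z \<in> ball y (\<delta> e) \<Longrightarrow> z \<in> closed_segment (fst e) (snd e)
          \<Longrightarrow> 2 *\<^sub>R y - z \<in> closed_segment (fst e) (snd e)"
      by metis
    define \<epsilon> where "\<epsilon> = Min (insert (\<epsilon>0 / 2) (insert (r - dist x y) (\<delta> ` F)))"
    have \<epsilon>: "0 < \<epsilon>" "\<epsilon> < \<epsilon>0" "\<epsilon> \<le> r - dist x y"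
    proof -
      show "0 < \<epsilon>" unfolding \<epsilon>_def using F(1) \<epsilon>0(1) \<delta>(1) y by (subst Min_gr_iff) auto
      have "\<epsilon> \<le> \<epsilon>0 / 2" unfolding \<epsilon>_def using F(1) by (intro Min_le) auto
      then show "\<epsilon> < \<epsilon>0" using \<epsilon>0(1) by simp
      show "\<epsilon> \<le> r - dist x y" unfolding \<epsilon>_def using F(1) by (intro Min_le) auto
    qed
    have \<epsilon>\<delta>: "\<epsilon> \<le> \<delta> e" if "e \<in> F" for e
      unfolding \<epsilon>_def using F(1) that by (intro Min_le) auto
    have inball: "z \<in> ball x r" if "z \<in> ball y \<epsilon>" for z
      using that \<epsilon>(3) dist_triangle[of x z y] by auto
    have "2 *\<^sub>R y - z \<in> S \<inter> ball y \<epsilon>" if z: "z \<in> S \<inter> ball y \<epsilon>" for z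
    proof -
      have "dist y (2 *\<^sub>R y - z) = dist y z" by (simp add: dist_norm scaleR_2 norm_minus_commute)
      then have b: "2 *\<^sub>R y - z \<in> ball y \<epsilon>" using z by simp
      have "z \<in> S \<inter> ball x r" using z inball by auto
      then obtain e where e: "e \<in> F" "z \<in> closed_segment (fst e) (snd e)" unfolding S by auto
      then have "2 *\<^sub>R y - z \<in> closed_segment (fst e) (snd e)"
        using \<delta>(2)[of e z] z \<epsilon>\<delta>[of e] by auto
      then have "2 *\<^sub>R y - z \<in> (\<Union>(a, b)\<in>F. closed_segment a b) \<inter> ball x r"
        using e(1) inball[OF b] by (intro IntI UN_I[of e]) (auto simp: case_prod_unfold)
      then show ?thesis using b S by blast
    qed
    then show False using regular_tripod_not_symmetric[OF \<epsilon>0(2)[OF \<epsilon>(1,2)]] by blast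
  qed
qed

section \<open>Spheres with few points\<close>

text \<open>This is \<open>(1 + 1 / p) ^ p \<le> exp 1 \<le> 3\<close>.\<close>

lemma three_mult_power_ge:
  assumes "1 \<le> p"
  shows "1 \<le> 3 * (1 - 1 / real (Suc p)) ^ p"
proof -
  have "(1 + 1 / real p) ^ p \<le> exp (1 / real p) ^ p"
    by (intro power_mono exp_ge_add_one_self) auto
  also have "\<dots> = exp 1" using assms by (simp flip: exp_of_nat_mult)
  also have "\<dots> \<le> 3" by (rule exp_le)
  finally have "(1 + 1 / real p) ^ p \<le> 3" .
  moreover have "(1 - 1 / real (Suc p)) * (1 + 1 / real p) = 1"
  proof -
    have "1 - 1 / real (Suc p) = real p / real (Suc p)" by (simp add: field_simps)
    moreover have "1 + 1 / real p = real (Suc p) / real p" using assms by (simp add: field_simps)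
    ultimately show ?thesis using assms by (simp del: of_nat_Suc)
  qed
  then have "(1 - 1 / real (Suc p)) ^ p * (1 + 1 / real p) ^ p = 1"
    by (metis power_mult_distrib power_one)
  moreover have "0 \<le> (1 - 1 / real (Suc p)) ^ p" by simp
  ultimately show ?thesis by (metis mult.commute mult_left_mono)
qed

text \<open>An a priori bound in place of solving the differential inequality for \<open>\<phi>\<close>.  Let \<open>\<Theta>\<close> be the supremum
  of \<open>\<phi> t * (s - t) ^ p\<close>, which is finite because \<open>\<phi>\<close> is bounded; the weight is the reciprocal of the rate at which a
  solution blows up at \<open>s\<close>.  At a radius \<open>r\<close> where the supremum is nearly attained, a step to
  \<open>b = r + (s - r) / q\<close> changes the weight only by a factor 3, so \<open>\<phi>\<close> grows on that step by a factor
  6 at most.  The isoperimetric inequality gives a lower bound for the number of points on all the spheres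
  between \<open>r\<close> and \<open>b\<close>, hence for that growth, and the two bounds limit \<open>\<phi> r\<close> and \<open>\<Theta>\<close>.
  If all spheres beyond \<open>\<rho> * s\<close> had many points, a step of the same kind from \<open>\<rho> * s\<close> would contradict
  the bound on \<open>\<Theta>\<close>.  The predicate \<open>Q t m\<close> stands for the presence of at least \<open>m\<close> points on the
  sphere of radius \<open>t\<close>.\<close>

lemma radius_with_few_points:
  fixes \<phi> :: "real \<Rightarrow> real" and Q :: "real \<Rightarrow> nat \<Rightarrow> bool"
  assumes q: "q = Suc p" "1 \<le> p" and s: "0 < s" and \<rho>: "0 < \<rho>" "\<rho> < 1"
    and \<phi>: "\<And>t. 0 \<le> \<phi> t" "\<And>t t'. t \<le> t' \<Longrightarrow> \<phi> t \<le> \<phi> t'" "\<And>t. \<phi> t \<le> B"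
    and growth: "\<And>a b m. 0 < a \<Longrightarrow> a < b \<Longrightarrow> b < s \<Longrightarrow> (\<And>t. a < t \<Longrightarrow> t < b \<Longrightarrow> Q t m)
        \<Longrightarrow> real m * (b - a) \<le> \<phi> b - \<phi> a"
    and isoperimetric: "\<And>t n. 0 < t \<Longrightarrow> t < s \<Longrightarrow> \<not> Q t (Suc n) \<Longrightarrow> \<phi> t ^ q \<le> (20 * s) ^ q * real n ^ p"
  obtains t n where "\<rho> * s < t" "t < s" "\<not> Q t (Suc n)" "real n \<le> (120 * real q / (1 - \<rho>)) ^ q"
proof (rule ccontr)
  define M where "M = (120 * real q / (1 - \<rho>)) ^ q"
  define m where "m = Suc (nat \<lfloor>M\<rfloor>)"
  define c where "c = 20 * s"
  assume "\<not> thesis"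
  then have many: "\<forall>t n. \<rho> * s < t \<longrightarrow> t < s \<longrightarrow> real n \<le> M \<longrightarrow> Q t (Suc n)"
    using that unfolding M_def by blast
  have M0: "0 \<le> M" using \<rho> by (simp add: M_def)
  have Mm: "M < real m" unfolding m_def using M0 by linarith
  have many': "Q t m" if "\<rho> * s < t" "t < s" for t
    unfolding m_def using that M0 many by auto
  define \<psi> where "\<psi> t = \<phi> t * (s - t) ^ p" for t
  define \<Theta> where "\<Theta> = (SUP t\<in>{0<..<s}. \<psi> t)"
  have bdd: "bdd_above (\<psi> ` {0<..<s})"
  proof (rule bdd_aboveI2)
    fix t assume "t \<in> {0<..<s}"
    then show "\<psi> t \<le> B * s ^ p" unfolding \<psi>_def
      using \<phi>(1,3)[of t] by (intro mult_mono power_mono) auto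
  qed
  have ne: "{0<..<s} \<noteq> {}" using s by auto
  have \<Theta>_ge: "\<psi> t \<le> \<Theta>" if "0 < t" "t < s" for t
    unfolding \<Theta>_def using that bdd by (intro cSUP_upper) auto
  have step: "\<phi> (t + (s - t) / real q) * (s - t) ^ p \<le> 3 * \<Theta>" "t + (s - t) / real q < s"
    if t: "0 < t" "t < s" for t
  proof -
    define b where "b = t + (s - t) / real q"
    have sb: "s - b = (s - t) * (1 - 1 / real q)" using q by (simp add: b_def field_simps)
    moreover have "0 < (s - t) * (1 - 1 / real q)" using t q by (intro mult_pos_pos) auto
    ultimately have "b < s" by simp
    then show "t + (s - t) / real q < s" by (simp add: b_def)
    have "0 < b" using t q by (simp add: b_def add_pos_nonneg)
    have "\<phi> b * (s - t) ^ p * 1 \<le> \<phi> b * (s - t) ^ p * (3 * (1 - 1 / real q) ^ p)"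
      using three_mult_power_ge[OF q(2)] t \<phi>(1)[of b] unfolding q(1) by (intro mult_left_mono) auto
    also have "\<dots> = 3 * \<psi> b" unfolding \<psi>_def sb by (simp add: power_mult_distrib)
    also have "\<dots> \<le> 3 * \<Theta>" using \<Theta>_ge \<open>b < s\<close> \<open>0 < b\<close> by simp
    finally show "\<phi> (t + (s - t) / real q) * (s - t) ^ p \<le> 3 * \<Theta>" by (simp add: b_def)
  qed
  have \<rho>s: "0 < \<rho> * s" "\<rho> * s < s" using \<rho> s by auto
  define \<delta> where "\<delta> = s - \<rho> * s"
  have \<delta>: "0 < \<delta>" using \<rho>s by (simp add: \<delta>_def)
  have m_le: "real m * \<delta> ^ q \<le> 3 * real q * \<Theta>"
  proof -
    have "real m * (\<rho> * s + \<delta> / real q - \<rho> * s) \<le> \<phi> (\<rho> * s + \<delta> / real q) - \<phi> (\<rho> * s)"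
      using \<rho>s q step(2)[OF \<rho>s] \<delta> unfolding \<delta>_def by (intro growth many') auto
    also have "\<dots> \<le> \<phi> (\<rho> * s + \<delta> / real q)" using \<phi>(1) by simp
    finally have "real m * (\<delta> / real q) * \<delta> ^ p \<le> \<phi> (\<rho> * s + \<delta> / real q) * \<delta> ^ p"
      using \<delta> by (intro mult_right_mono) auto
    also have "\<dots> \<le> 3 * \<Theta>" using step(1)[OF \<rho>s] by (simp add: \<delta>_def)
    finally have "real q * (real m * (\<delta> / real q) * \<delta> ^ p) \<le> real q * (3 * \<Theta>)"
      by (rule mult_left_mono) simp
    moreover have "real q * (real m * (\<delta> / real q) * \<delta> ^ p) = real m * \<delta> ^ q"
      using q by simp
    ultimately show ?thesis by simp
  qed
  have \<Theta>0: "0 < \<Theta>"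
  proof -
    have "0 < real m * \<delta> ^ q" using \<delta> by (simp add: m_def)
    also have "\<dots> \<le> 3 * real q * \<Theta>" by (rule m_le)
    finally show ?thesis using q by (simp add: zero_less_mult_iff)
  qed
  then have "\<Theta> / 2 < (SUP t\<in>{0<..<s}. \<psi> t)" unfolding \<Theta>_def[symmetric] by simp
  then obtain r where r: "0 < r" "r < s" "\<Theta> / 2 < \<psi> r"
    using less_cSUP_iff[OF ne bdd] by auto
  have sr: "0 < (s - r) ^ p" using r by simp
  have \<phi>r: "0 < \<phi> r"
  proof (rule ccontr)
    assume "\<not> 0 < \<phi> r"
    then have "\<phi> r = 0" using \<phi>(1)[of r] by linarith
    then show False using r(3) \<Theta>0 by (simp add: \<psi>_def)
  qed
  have c0: "0 < c" using s by (simp add: c_def)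
  define b where "b = r + (s - r) / real q"
  have b: "r < b" "b < s" using r q step(2)[OF r(1,2)] by (auto simp: b_def)
  have "\<phi> b * (s - r) ^ p < 6 * \<phi> r * (s - r) ^ p"
    using step(1)[OF r(1,2)] r(3) unfolding b_def[symmetric] \<psi>_def by linarith
  then have \<phi>b: "\<phi> b < 6 * \<phi> r" using sr by simp
  \<comment> \<open>the number of points that the isoperimetric inequality forces on each sphere beyond \<open>r\<close>\<close>
  define y where "y = root p ((\<phi> r / c) ^ q)"
  have y: "0 < y" "y ^ p = (\<phi> r / c) ^ q" using q \<phi>r c0 by (auto simp: y_def)
  define k where "k = nat \<lceil>y\<rceil> - 1"
  have k: "Suc k = nat \<lceil>y\<rceil>" "real k < y" using y(1) by (auto simp: k_def) linarith
  have "Q t (Suc k)" if t: "r < t" "t < b" for t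
  proof (rule ccontr)
    assume "\<not> ?thesis"
    then have "\<phi> t ^ q \<le> c ^ q * real k ^ p" unfolding c_def using t r b by (intro isoperimetric) auto
    also have "\<dots> < c ^ q * y ^ p"
      using k(2) q(2) c0 by (intro mult_strict_left_mono power_strict_mono) auto
    also have "\<dots> = \<phi> r ^ q" using c0 by (simp add: y(2) power_divide)
    also have "\<dots> \<le> \<phi> t ^ q" using t \<phi>r by (intro power_mono \<phi>(2)) auto
    finally show False by simp
  qed
  then have "real (Suc k) * (b - r) \<le> \<phi> b - \<phi> r" using r b by (intro growth) auto
  moreover have "y * (b - r) \<le> real (Suc k) * (b - r)"
    using b y(1) unfolding k(1) by (intro mult_right_mono) linarith+
  ultimately have "y * (b - r) \<le> 6 * \<phi> r" using \<phi>b \<phi>r by linarith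
  then have "y * (s - r) \<le> 6 * real q * \<phi> r" using q by (simp add: b_def field_simps)
  then have "(y * (s - r)) ^ p \<le> (6 * real q * \<phi> r) ^ p" using y r by (intro power_mono) auto
  then have "(\<phi> r / c) ^ q * (s - r) ^ p \<le> (6 * real q) ^ p * \<phi> r ^ p"
    by (simp add: power_mult_distrib y(2))
  then have "\<phi> r ^ p * (\<phi> r * (s - r) ^ p) \<le> \<phi> r ^ p * ((6 * real q) ^ p * c ^ q)"
    using c0 by (simp add: q(1) field_simps)
  then have "\<psi> r \<le> (6 * real q) ^ p * c ^ q"
    using \<phi>r unfolding \<psi>_def by (subst (asm) mult_le_cancel_left_pos) auto
  then have "\<Theta> < 2 * ((6 * real q) ^ p * c ^ q)" using r(3) by linarith
  then have "3 * real q * \<Theta> < 3 * real q * (2 * ((6 * real q) ^ p * c ^ q))"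
    using q by (intro mult_strict_left_mono) auto
  also have "\<dots> = (6 * real q) ^ q * c ^ q" by (simp add: q(1))
  also have "\<dots> = (120 * real q * s) ^ q"

  proof -
    have "120 * real q * s = (6 * real q) * c" by (simp add: c_def)
    then show ?thesis by (metis power_mult_distrib)
  qed
  finally have "real m * \<delta> ^ q < (120 * real q * s) ^ q" using m_le by linarith
  also have "120 * real q * s = 120 * real q / (1 - \<rho>) * \<delta>" using \<rho> by (simp add: \<delta>_def field_simps)
  also have "(120 * real q / (1 - \<rho>) * \<delta>) ^ q = M * \<delta> ^ q" by (simp only: M_def power_mult_distrib)
  finally have "real m < M" using \<delta> by (simp add: zero_less_power)
  then show False using Mm by simp
qed

lemma connected_avoiding_sphere:
  fixes S :: "'a::metric_space set"
  assumes "connected S" "S \<inter> sphere x r = {}" "\<not> S \<subseteq> ball x r"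
  shows "S \<inter> ball x r = {}"
proof (rule ccontr)
  assume "S \<inter> ball x r \<noteq> {}"
  then obtain p z where "p \<in> S" "dist x p < r" "z \<in> S" "r \<le> dist x z"
    using assms(3) by (auto simp: not_less)
  then obtain w where "w \<in> S" "dist x w = r"
    using connected_meets_sphere[OF assms(1), of p z x r] by auto
  then show False using assms(2) by auto
qed

text \<open>The part of \<open>S\<close> in the closed ball competes with a connected set through the points of \<open>S\<close> on the
  sphere.  If there are no such points, then \<open>S\<close> does not enter the ball.\<close>

lemma steiner_set_isoperimetric:
  fixes A S :: "'a::euclidean_space set"
  assumes S: "steiner_set A S" "connected S" "hausdorff1 S < \<infinity>"
    and A: "cball x r \<inter> A = {}" and out: "\<not> S \<subseteq> ball x r"
    and dim: "DIM('a) = Suc q" "2 \<le> q"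
    and P: "finite (S \<inter> sphere x r)" and r: "0 < r"
  shows "enn2real (hausdorff1 (S \<inter> ball x r)) ^ q
    \<le> (20 * r) ^ q * real (card (S \<inter> sphere x r)) ^ (q - 1)"
proof (cases "S \<inter> sphere x r = {}")
  case True
  have "S \<inter> ball x r = {}" using connected_avoiding_sphere[OF S(2) True out] .
  then show ?thesis using dim(2) by (simp add: True power_0_left)
next
  case False
  define n where "n = card (S \<inter> sphere x r)"
  have n: "0 < n" using False P by (simp add: n_def card_gt_0_iff)
  obtain G where G: "connected G" "S \<inter> sphere x r \<subseteq> G"
      "hausdorff1 G \<le> ennreal (20 * r * real n / root q n)"
    using connect_points_on_sphere[OF P False _ _ dim, of x r] r unfolding n_def by auto
  have "closed S" using S(1) by (simp add: steiner_set_def)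
  have "hausdorff1 (S \<inter> ball x r) \<le> hausdorff1 (S \<inter> cball x r)"
    by (intro hausdorff1_mono) auto
  also have "\<dots> \<le> hausdorff1 G"
  proof (rule steiner_set_part_minimal[OF S(1,3), where W = "ball x r"])
    show "closed (S \<inter> cball x r)" using \<open>closed S\<close> by auto
    show "S \<inter> cball x r \<inter> A = {}" using A by blast
    show "G \<inter> S \<noteq> {}" using G(2) False by blast
    show "S \<inter> cball x r - G \<subseteq> ball x r" using G(2) by (auto simp: less_le)
    have "ball x r \<subseteq> cball x r" by auto
    then show "ball x r \<inter> (S \<union> A) \<subseteq> S \<inter> cball x r" using A by blast
  qed (use G in auto)
  also have "\<dots> \<le> ennreal (20 * r * real n / root q n)" by (rule G)
  finally have "enn2real (hausdorff1 (S \<inter> ball x r)) \<le> 20 * r * real n / root q n"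
    using r dim(2) by (intro enn2real_leI) auto
  then have "enn2real (hausdorff1 (S \<inter> ball x r)) ^ q \<le> (20 * r * real n / root q n) ^ q"
    by (intro power_mono) auto
  also have "\<dots> = (20 * r) ^ q * (real n ^ q / real n)"
    using dim(2) by (simp add: power_mult_distrib power_divide)
  also have "real n ^ q / real n = real n ^ (q - 1)"
    using n dim(2) by (simp add: power_diff)
  finally show ?thesis unfolding n_def .
qed

text \<open>Eilenberg's inequality for the distance from \<open>x\<close> on the part of \<open>S\<close> in an annulus.\<close>

lemma hausdorff1_ball_growth:
  fixes S :: "'a::metric_space set"
  assumes fin: "hausdorff1 S < \<infinity>" and ab: "a < b"
    and many: "\<And>t. a < t \<Longrightarrow> t < b \<Longrightarrow> \<exists>P\<subseteq>S \<inter> sphere x t. finite P \<and> m \<le> card P"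
  shows "real m * (b - a) \<le> enn2real (hausdorff1 (S \<inter> ball x b)) - enn2real (hausdorff1 (S \<inter> ball x a))"
proof -
  have "closed (- ball x a)" by auto
  note split = hausdorff1_split[OF this, of "S \<inter> ball x b"]
  have "ennreal (real m * (b - a)) \<le> hausdorff1 (S \<inter> ball x b \<inter> - ball x a)"
  proof (rule hausdorff1_ge_level_count[where f = "dist x"])
    show "\<bar>dist x y - dist x z\<bar> \<le> dist y z" for y z
      using dist_triangle[of x y z] dist_triangle[of x z y] by (simp add: dist_commute)
    fix t assume t: "a < t" "t < b"
    then obtain P where P: "P \<subseteq> S \<inter> sphere x t" "finite P" "m \<le> card P" using many by blast
    then show "\<exists>P\<subseteq>S \<inter> ball x b \<inter> - ball x a. finite P \<and> m \<le> card P \<and> (\<forall>p\<in>P. dist x p = t)"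
      using t by (intro exI[of _ P]) auto
  qed (use ab in simp)
  moreover have "S \<inter> ball x b - - ball x a = S \<inter> ball x a" using ab by auto
  ultimately have le: "ennreal (real m * (b - a)) + hausdorff1 (S \<inter> ball x a) \<le> hausdorff1 (S \<inter> ball x b)"
    unfolding split by (simp add: add_right_mono)
  have "hausdorff1 (S \<inter> ball x t) < top" for t
    using le_less_trans[OF hausdorff1_mono[of "S \<inter> ball x t" S] fin] by simp
  then obtain u v where uv: "hausdorff1 (S \<inter> ball x a) = ennreal u" "0 \<le> u"
      "hausdorff1 (S \<inter> ball x b) = ennreal v" "0 \<le> v"
    by (metis ennreal_cases less_irrefl)
  have "0 \<le> real m * (b - a)" using ab by simp
  then have "ennreal (real m * (b - a) + u) \<le> ennreal v" using le uv by simp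
  then show ?thesis using uv by simp
qed

text \<open>Otherwise \<open>S\<close> and \<open>A\<close> would separate \<open>S \<union> A\<close>.\<close>

lemma steiner_set_not_in_ball:
  fixes A S :: "'a::euclidean_space set"
  assumes S: "steiner_set A S" and A: "closed A" "A \<noteq> {}"
    and ball: "cball x t \<inter> A = {}" and ne: "S \<noteq> {}"
  shows "\<not> S \<subseteq> ball x t"
proof
  assume sub: "S \<subseteq> ball x t"
  have "ball x t \<subseteq> cball x t" by auto
  then have "S \<inter> A = {}" using sub ball by blast
  moreover have "closed S" "connected (S \<union> A)" using S by (auto simp: steiner_set_def)
  ultimately show False using connected_closedD[of "S \<union> A" S A] A ne by blast
qed

lemma steiner_set_sphere_few_points:
  fixes A S :: "'a::euclidean_space set"
  assumes S: "steiner_set A S" "connected S" "hausdorff1 S < \<infinity>"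
    and A: "ball x s \<inter> A = {}" and out: "\<And>t. t < s \<Longrightarrow> \<not> S \<subseteq> ball x t"
    and dim: "DIM('a) = Suc q" "2 \<le> q" and s: "0 < s" and \<rho>: "0 < \<rho>" "\<rho> < 1"
  obtains t where "\<rho> * s < t" "t < s" "finite (S \<inter> sphere x t)"
    "real (card (S \<inter> sphere x t)) \<le> (120 * real q / (1 - \<rho>)) ^ q"
proof -
  define \<phi> where "\<phi> t = enn2real (hausdorff1 (S \<inter> ball x t))" for t
  define Q where "Q t m \<longleftrightarrow> (\<exists>P\<subseteq>S \<inter> sphere x t. finite P \<and> m \<le> card P)" for t m
  have fin: "hausdorff1 (S \<inter> ball x t) < top" for t
    using le_less_trans[OF hausdorff1_mono[of "S \<inter> ball x t" S] S(3)] by simp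
  have few: "finite (S \<inter> sphere x t) \<and> card (S \<inter> sphere x t) \<le> n" if nQ: "\<not> Q t (Suc n)" for t n
  proof -
    have "finite (S \<inter> sphere x t)"
    proof (rule ccontr)
      assume "infinite (S \<inter> sphere x t)"
      then obtain P where "finite P" "card P = Suc n" "P \<subseteq> S \<inter> sphere x t"
        using infinite_arbitrarily_large by metis
      then have "Q t (Suc n)" unfolding Q_def by (intro exI[of _ P]) simp
      then show False using nQ by simp
    qed
    moreover have "\<not> Suc n \<le> card (S \<inter> sphere x t)"
      using nQ calculation unfolding Q_def by blast
    ultimately show ?thesis by simp
  qed
  have q: "q = Suc (q - 1)" "1 \<le> q - 1" using dim(2) by auto
  obtain t n where tn: "\<rho> * s < t" "t < s" "\<not> Q t (Suc n)" "real n \<le> (120 * real q / (1 - \<rho>)) ^ q"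
  proof (rule radius_with_few_points[OF q s \<rho>, of \<phi> "enn2real (hausdorff1 S)" Q])
    show "0 \<le> \<phi> t" for t by (simp add: \<phi>_def)
    show "\<phi> t \<le> \<phi> t'" if "t \<le> t'" for t t'
      unfolding \<phi>_def using that fin by (intro enn2real_mono hausdorff1_mono) auto
    show "\<phi> t \<le> enn2real (hausdorff1 S)" for t
      unfolding \<phi>_def using S(3) by (intro enn2real_mono hausdorff1_mono) auto
    show "real m * (b - a) \<le> \<phi> b - \<phi> a" if "a < b" "\<And>t. a < t \<Longrightarrow> t < b \<Longrightarrow> Q t m" for a b m
      unfolding \<phi>_def using that unfolding Q_def by (intro hausdorff1_ball_growth S(3))
    fix t n assume t: "0 < t" "t < s" and nQ: "\<not> Q t (Suc n)"
    have "cball x t \<subseteq> ball x s" using t by auto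
    then have "cball x t \<inter> A = {}" using A by blast
    then have "\<phi> t ^ q \<le> (20 * t) ^ q * real (card (S \<inter> sphere x t)) ^ (q - 1)"
      unfolding \<phi>_def using few[OF nQ] t by (intro steiner_set_isoperimetric[OF S _ out dim]) auto
    also have "\<dots> \<le> (20 * s) ^ q * real n ^ (q - 1)"
      using few[OF nQ] t by (intro mult_mono power_mono) auto
    finally show "\<phi> t ^ q \<le> (20 * s) ^ q * real n ^ (q - 1)" .
  qed (rule that)
  then show ?thesis using few[OF tn(3)] that[of t] by force
qed

section \<open>Counting segments and branching points\<close>

theorem corollary2:
  fixes A S :: "(real ^ 'd) set" and x :: "real ^ 'd" and s \<rho> :: real
  assumes "CARD('d) > 2"
    and "compact A"
    and "steiner_tree A S"
    and "hausdorff1 S < \<infinity>"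
    and "s > 0"
    and "ball x s \<inter> A = {}"
    and "0 < \<rho>" and "\<rho> < 1"
  shows "(\<exists>F. finite F
            \<and> real (card F) \<le> (144 * real CARD('d) / (1 - \<rho>)) ^ (CARD('d) - 1)
            \<and> (\<forall>T\<in>F. line_segment T)
            \<and> S \<inter> ball x (\<rho> * s) = \<Union>F)
       \<and> finite (branching_points A S \<inter> ball x (\<rho> * s))
       \<and> real (card (branching_points A S \<inter> ball x (\<rho> * s)))
            \<le> (144 * real CARD('d) / (1 - \<rho>)) ^ (CARD('d) - 1)"
proof -
  define q where "q = CARD('d) - 1"
  define N where "N = (144 * real CARD('d) / (1 - \<rho>)) ^ q"
  have q: "CARD('d) = Suc q" "2 \<le> q" using assms(1) by (auto simp: q_def)
  have dim: "DIM(real ^ 'd) = Suc q" by (simp add: q)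
  have S: "steiner_set A S" "connected S" using assms(3) by (auto simp: steiner_tree_def)
  have N1: "1 \<le> N"
  proof -
    have "1 - \<rho> \<le> 144 * real CARD('d)" using assms(1,7) by simp
    then have "1 \<le> 144 * real CARD('d) / (1 - \<rho>)" using assms(8) by simp
    then show ?thesis unfolding N_def by (rule one_le_power)
  qed
  have "\<exists>V F r. \<rho> * s < r \<and> finite V \<and> real (card V) \<le> N \<and> finite F \<and> real (card F) \<le> N \<and>
      F \<subseteq> V \<times> V \<and> S \<inter> ball x r = (\<Union>(a, b)\<in>F. closed_segment a b) \<inter> ball x r"
  proof (cases "S = {} \<or> A = {}")
    \<comment> \<open>if \<open>A\<close> is empty, then the empty set is a competitor and \<open>S\<close> is at most a point\<close>
    case True
    then have "\<exists>p. S \<subseteq> {p}"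
    proof
      assume "A = {}"
      then have "hausdorff1 S \<le> hausdorff1 ({} :: (real ^ 'd) set)"
        using S(1) unfolding steiner_set_def by (metis connected_empty Un_empty)
      then have "y = z" if "y \<in> S" "z \<in> S" for y z
        using hausdorff1_connected_ge_dist[OF S(2) that] by simp
      then show ?thesis by blast
    qed auto
    then obtain p where "S \<subseteq> {p}" by blast
    then consider "S = {}" | "S = {p}" by blast
    then show ?thesis
    proof cases
      case 1
      then show ?thesis using N1
        by (intro exI[of _ "{}"] exI[of _ "\<rho> * s + 1"]) auto
    next
      case 2
      then show ?thesis using N1
        by (intro exI[of _ "{p}"] exI[of _ "{(p, p)}"] exI[of _ "\<rho> * s + 1"]) auto
    qed
  next
    case False
    have inner: "cball x t \<inter> A = {}" if "t < s" for t
    proof -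
      have "cball x t \<subseteq> ball x s" using that by auto
      then show ?thesis using assms(6) by blast
    qed
    have out: "\<not> S \<subseteq> ball x t" if "t < s" for t
      using steiner_set_not_in_ball[OF S(1) compact_imp_closed[OF assms(2)]]
        inner[OF that] False by blast
    then obtain t where t: "\<rho> * s < t" "t < s" "finite (S \<inter> sphere x t)"
        "real (card (S \<inter> sphere x t)) \<le> (120 * real q / (1 - \<rho>)) ^ q"
      using steiner_set_sphere_few_points[OF S assms(4,6) _ dim q(2) assms(5,7,8)] by blast
    \<comment> \<open>Bernoulli's inequality absorbs the 2 by passing from \<open>q\<close> to the dimension \<open>q + 1\<close>\<close>
    have bound: "2 * (120 * real q / (1 - \<rho>)) ^ q \<le> N"
    proof -
      have "2 \<le> 1 + real q * (1 / q)" using q(2) by simp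
      also have "\<dots> \<le> (1 + 1 / q) ^ q" by (rule Bernoulli_inequality) (rule order_trans[of _ 0], auto)
      finally have "2 * (120 * real q / (1 - \<rho>)) ^ q \<le> (1 + 1 / q) ^ q * (120 * real q / (1 - \<rho>)) ^ q"
        using assms(8) by (intro mult_right_mono) auto
      also have "\<dots> = ((1 + 1 / q) * (120 * real q / (1 - \<rho>))) ^ q" by (rule power_mult_distrib[symmetric])
      also have "(1 + 1 / q) * (120 * real q / (1 - \<rho>)) = 120 * real (Suc q) / (1 - \<rho>)"
      proof -
        have "(1 + 1 / real q) * real q = real (Suc q)" using q(2) by (simp add: field_simps)
        moreover have "(1 + 1 / real q) * (120 * real q / (1 - \<rho>))
            = 120 * ((1 + 1 / real q) * real q) / (1 - \<rho>)" by simp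
        ultimately show ?thesis by simp
      qed
      also have "(120 * real (Suc q) / (1 - \<rho>)) ^ q \<le> N"
        unfolding N_def q(1) using assms(8) by (intro power_mono divide_right_mono) auto
      finally show ?thesis .
    qed
    show ?thesis
    proof (cases "S \<inter> sphere x t = {}")
      case True
      have "S \<inter> ball x t = {}" using connected_avoiding_sphere[OF S(2) True out[OF t(2)]] .
      then show ?thesis using N1 t(1) by (intro exI[of _ "{}"] exI[of _ t]) auto
    next
      case False
      obtain V F where VF: "finite V" "card V \<le> 2 * card (S \<inter> sphere x t)"
          "finite F" "card F \<le> 2 * card (S \<inter> sphere x t)" "F \<subseteq> V \<times> V"
          "S \<inter> ball x t = (\<Union>(a, b)\<in>F. closed_segment a b) \<inter> ball x t"
        using steiner_set_in_ball_is_union_of_segments[OF S assms(4) inner[OF t(2)] t(3) False] by blast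
      have "real (card V) \<le> N" "real (card F) \<le> N" using VF(2,4) t(4) bound by linarith+
      then show ?thesis using VF t(1) by blast
    qed
  qed
  then obtain V F r where r: "\<rho> * s < r" and V: "finite V" "real (card V) \<le> N"
      and F: "finite F" "real (card F) \<le> N" "F \<subseteq> V \<times> V"
      and SF: "S \<inter> ball x r = (\<Union>(a, b)\<in>F. closed_segment a b) \<inter> ball x r" by blast
  have sub: "ball x (\<rho> * s) \<subseteq> ball x r" using r by (intro subset_ball) simp
  define pieces where "pieces = (\<lambda>(a, b). closed_segment a b \<inter> ball x (\<rho> * s)) ` F"
  have "finite pieces" "real (card pieces) \<le> N"
    using F(1,2) card_image_le[OF F(1)] unfolding pieces_def by (auto intro: order_trans[OF of_nat_mono])
  moreover have "\<forall>T\<in>pieces. line_segment T"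
    unfolding pieces_def by (auto intro!: convex_subset_of_segment convex_Int)
  moreover have "S \<inter> ball x (\<rho> * s) = \<Union>pieces"
  proof -
    have "S \<inter> ball x (\<rho> * s) = (S \<inter> ball x r) \<inter> ball x (\<rho> * s)" using sub by blast
    also have "\<dots> = \<Union>pieces" unfolding SF pieces_def using sub by fastforce
    finally show ?thesis .
  qed
  moreover have "branching_points A S \<inter> ball x (\<rho> * s) \<subseteq> V"
    using branching_points_are_endpoints[OF F(1,3) SF, of A] sub by blast
  then have "finite (branching_points A S \<inter> ball x (\<rho> * s))"
      "card (branching_points A S \<inter> ball x (\<rho> * s)) \<le> card V"
    using V(1) by (auto intro: finite_subset card_mono)
  moreover from this have "real (card (branching_points A S \<inter> ball x (\<rho> * s))) \<le> N"
    using V(2) by linarith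
  ultimately show ?thesis unfolding N_def q_def by blast
qed

end
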